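(* For all integers $p,q\ge1$ and every real $r\in[0,2)$, the Kleinberg random network model $\mathbb{KL}(r,p,q)$ is idemetric: there exists a finite-valued function $f$ such that if $G_n$ is sampled from $\mathbb{KL}(r,p,q)$ and $u_n,v_n$ are nodes chosen uniformly at random from $G_n$, then $d(u_n,v_n)/f(n)$ converges in probability to $1$ as $n\to\infty$ (through square numbers $n$).
   Context: Kleinberg model $\mathbb{KL}(r,p,q)$: for a square number $n$, the nodes are the lattice points $\{(x,y):x,y\in\{1,\dots,\sqrt n\}\}$. The lattice distance $d_\ell((x,y),(s,t))$ is the minimum of $|s'-x'|+|t'-y'|$ over $x'\in\{x,x\pm\sqrt n\}$, $y'\in\{y,y\pm\sqrt n\}$, $s'\in\{s,s\pm\sqrt n\}$, $t'\in\{t,t\pm\sqrt n\}$ (periodic boundary). Each node $u$ has a directed edge to every other node within lattice distance $p$. In addition each node $u$ gets $q$ directed long-range edges to nodes chosen by independent random trials, where the $i$th long-range edge from $u$ has endpoint $v$ with probability proportional to $d_\ell(u,v)^{-r}$ (normalised to a probability distribution; for $r=0$ the convention $0^0=1$ is used, so $u$ may be its own contact). $d(a,b)$ is the length of a shortest directed path from $a$ to $b$ ($\infty$ if none). Convergence in probability: for every $\epsilon>0$, $\mathbb{P}(|d(u_n,v_n)/f(n)-1|>\epsilon)\to0$. *)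

theory Defs
  imports "HOL-Probability.Probability"
begin

type_synonym node = "nat \<times> nat"

text \<open>Nodes of KL(r,p,q) for n = m^2 (m = sqrt n): lattice points with coordinates in 1..m.\<close>
definition kl_nodes :: "nat \<Rightarrow> node set" where
  "kl_nodes m = {1..m} \<times> {1..m}"

definition lat_dist :: "nat \<Rightarrow> node \<Rightarrow> node \<Rightarrow> int" where
  "lat_dist m u v = (case (u, v) of ((x, y), (s, t)) \<Rightarrow>
     Min {\<bar>s' - x'\<bar> + \<bar>t' - y'\<bar> | x' y' s' t'.
            x' \<in> {int x, int x + int m, int x - int m} \<and>
            y' \<in> {int y, int y + int m, int y - int m} \<and>
            s' \<in> {int s, int s + int m, int s - int m} \<and>
            t' \<in> {int t, int t + int m, int t - int m}})"

text \<open>Unnormalised weight d(u,v)^(-r), with the convention 0^0 = 1 for r = 0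
  (for r > 0 the weight of u itself is 0, since Isabelle's 0 powr a = 0).\<close>
definition lr_weight :: "nat \<Rightarrow> real \<Rightarrow> node \<Rightarrow> node \<Rightarrow> real" where
  "lr_weight m r u v = (if r = 0 then 1 else (real_of_int (lat_dist m u v)) powr (- r))"

definition lr_total :: "nat \<Rightarrow> real \<Rightarrow> node \<Rightarrow> real" where
  "lr_total m r u = (\<Sum>v\<in>kl_nodes m. lr_weight m r u v)"

text \<open>Distribution of one long-range contact of u (degenerate case of zero total
  weight, only possible for m = 1, is resolved arbitrarily as u itself).\<close>
definition contact_pmf :: "nat \<Rightarrow> real \<Rightarrow> node \<Rightarrow> node pmf" where
  "contact_pmf m r u =
     (if lr_total m r u = 0 then return_pmf u
      else embed_pmf (\<lambda>v. if v \<in> kl_nodes m then lr_weight m r u v / lr_total m r u else 0))"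

text \<open>A sample of the long-range edges: L (u,i) is the endpoint of the i-th long-range
  edge of u (i < q). All q*n trials are independent.\<close>
definition kl_long :: "nat \<Rightarrow> real \<Rightarrow> nat \<Rightarrow> (node \<times> nat \<Rightarrow> node) pmf" where
  "kl_long m r q = Pi_pmf (kl_nodes m \<times> {..<q}) (0, 0) (\<lambda>(u, i). contact_pmf m r u)"

definition kl_edges :: "nat \<Rightarrow> nat \<Rightarrow> nat \<Rightarrow> (node \<times> nat \<Rightarrow> node) \<Rightarrow> node rel" where
  "kl_edges m p q L = {(u, v). u \<in> kl_nodes m \<and> v \<in> kl_nodes m \<and>
      ((u \<noteq> v \<and> lat_dist m u v \<le> int p) \<or> (\<exists>i<q. L (u, i) = v))}"

text \<open>Shortest directed path length (infinity if no path).\<close>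
definition graph_dist :: "node rel \<Rightarrow> node \<Rightarrow> node \<Rightarrow> enat" where
  "graph_dist E a b = Inf {enat k | k. (a, b) \<in> E ^^ k}"

definition kl_dist_pmf :: "real \<Rightarrow> nat \<Rightarrow> nat \<Rightarrow> nat \<Rightarrow> enat pmf" where
  "kl_dist_pmf r p q m = do {
      L \<leftarrow> kl_long m r q;
      u \<leftarrow> pmf_of_set (kl_nodes m);
      v \<leftarrow> pmf_of_set (kl_nodes m);
      return_pmf (graph_dist (kl_edges m p q L) u v) }"

definition deviates :: "real \<Rightarrow> real \<Rightarrow> enat \<Rightarrow> bool" where
  "deviates fn eps d = (d = \<infinity> \<or> \<bar>real (the_enat d) / fn - 1\<bar> > eps)"

end

theory Submission
  imports Defs "HOL-Real_Asymp.Real_Asymp"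
begin

text \<open>
  Explore the network from a node \<open>u\<close>. Every node has exactly \<open>q\<close> long-range contacts and local balls
  of a given radius all have the same size, so in the absence of collisions the ball of radius \<open>t\<close> has
  a deterministic size \<open>a\<^sub>t\<close>, and \<open>a\<^sub>t\<close> is always an upper bound. A contact falls into a given set of
  density \<open>x\<close> with probability at most \<open>K x\<^bsup>\<gamma>\<^esup>\<close> for some \<open>\<gamma> > 0\<close> (this uses \<open>r < 2\<close>), and \<open>a\<^sub>t\<close> grows
  geometrically, so the expected size of the ball is at least \<open>(1 - O((a\<^sub>t / n)\<^bsup>\<gamma>\<^esup>)) a\<^sub>t\<close>; by Markov's
  inequality the ball has size \<open>(1 - o(1)) a\<^sub>t\<close> with high probability as long as \<open>a\<^sub>t = o(n)\<close>.

  Let \<open>f n\<close> be the least \<open>T\<close> with \<open>n \<le> \<surd>T a\<^sub>T\<close>. The ball of radius \<open>T - 1\<close> contains at most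
  \<open>n / \<surd>(T - 1)\<close> nodes, so a uniform node \<open>v\<close> is at distance at least \<open>T\<close> with high probability. On the
  other hand its outermost shell has order \<open>n / \<surd>T\<close> nodes, whose contacts have not yet been inspected,
  and each contact hits the local ball of radius \<open>\<epsilon> T\<close> around \<open>v\<close> with probability of order at least
  \<open>\<epsilon> T / n\<close>. Hence with high probability one of them does, and \<open>v\<close> is within distance \<open>(1 + \<epsilon>) T\<close>.
\<close>

subsection \<open>The torus metric\<close>

text \<open>The distance on the cycle of length \<open>m\<close>, as the shorter of the two directed
  gaps. Residues turn translation invariance and the comparison with lifted coordinates into
  congruences.\<close>

definition cyc_dist :: "nat \<Rightarrow> nat \<Rightarrow> nat \<Rightarrow> int" where
  "cyc_dist m x s = min ((int s - int x) mod int m) ((int x - int s) mod int m)"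

lemma cyc_dist_le_abs:
  assumes "m > 0" "(s' - x') mod int m = (int s - int x) mod int m"
  shows "cyc_dist m x s \<le> \<bar>s' - x'\<bar>"
proof -
  have neg: "(x' - s') mod int m = (int x - int s) mod int m"
    using assms(2) mod_minus_cong[of "s' - x'" "int m" "int s - int x"] by simp
  show ?thesis
  proof (cases "s' - x' \<ge> 0")
    case True
    then have "(s' - x') mod int m \<le> s' - x'"
      by (simp add: zmod_le_nonneg_dividend)
    then show ?thesis using True assms(2) by (simp add: cyc_dist_def)
  next
    case False
    then have "(x' - s') mod int m \<le> x' - s'"
      by (simp add: zmod_le_nonneg_dividend)
    then show ?thesis using False neg by (simp add: cyc_dist_def)
  qed
qed

text \<open>As the coordinates differ by less than \<open>m\<close>, the two directed gaps of
  distinct points are the absolute difference and its complement to \<open>m\<close>; shifting one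
  endpoint realises either.\<close>

lemma cyc_dist_attained:
  assumes "x \<in> {1..m}" "s \<in> {1..m}"
  shows "\<exists>x' \<in> {int x, int x + int m, int x - int m}. cyc_dist m x s = \<bar>int s - x'\<bar>"
proof -
  define k where "k = int s - int x"
  have k: "- int m < k" "k < int m" using assms by (auto simp: k_def)
  have mod_pos: "j mod int m = j" if "0 \<le> j" "j < int m" for j :: int
    using that by simp
  have mod_neg: "j mod int m = j + int m" if "j < 0" "- int m < j" for j :: int
  proof -
    have "j mod int m = (j + int m) mod int m" by simp
    also have "\<dots> = j + int m" using that by (intro mod_pos) auto
    finally show ?thesis .
  qed
  consider "k = 0" | "k > 0" | "k < 0" by linarith
  then show ?thesis
  proof cases
    case 1
    then show ?thesis by (auto simp: cyc_dist_def k_def)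
  next
    case 2
    then have "cyc_dist m x s = min k (int m - k)"
      using mod_pos[of k] mod_neg[of "-k"] k by (auto simp: cyc_dist_def k_def)
    then have "cyc_dist m x s = \<bar>int s - int x\<bar> \<or> cyc_dist m x s = \<bar>int s - (int x + int m)\<bar>"
      using 2 k by (auto simp: k_def min_def)
    then show ?thesis by blast
  next
    case 3
    then have "cyc_dist m x s = min (k + int m) (- k)"
      using mod_neg[of k] mod_pos[of "-k"] k by (auto simp: cyc_dist_def k_def)
    then have "cyc_dist m x s = \<bar>int s - int x\<bar> \<or> cyc_dist m x s = \<bar>int s - (int x - int m)\<bar>"
      using 3 k by (auto simp: k_def min_def)
    then show ?thesis by blast
  qed
qed

text \<open>The lifts of the two coordinates are chosen independently, so the minimum splits.
  \<open>cyc_dist_le_abs\<close> bounds it from below, and \<open>cyc_dist_attained\<close> gives a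
  minimiser whose second endpoint is not shifted.\<close>

lemma lat_dist_eq_cyc_dist:
  assumes "x \<in> {1..m}" "y \<in> {1..m}" "s \<in> {1..m}" "t \<in> {1..m}"
  shows "lat_dist m (x, y) (s, t) = cyc_dist m x s + cyc_dist m y t"
proof -
  define near where "near x = {int x, int x + int m, int x - int m}" for x
  define F where "F = (\<lambda>(x', y', s', t'). \<bar>s' - x'\<bar> + \<bar>t' - y'\<bar> :: int)
     ` (near x \<times> near y \<times> near s \<times> near t)"
  have m: "m > 0" using assms by auto
  have md: "(s' - x') mod int m = (int s - int x) mod int m"
    if "x' \<in> near x" "s' \<in> near s" for x' s' x s
  proof -
    have "x' mod int m = int x mod int m" "s' mod int m = int s mod int m"
      using that by (auto simp: near_def)
    then show ?thesis by (metis mod_diff_cong)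
  qed
  have fin: "finite F" by (auto simp: F_def near_def)
  obtain x' where x': "x' \<in> near x" "cyc_dist m x s = \<bar>int s - x'\<bar>"
    using cyc_dist_attained[OF assms(1,3)] unfolding near_def by blast
  obtain y' where y': "y' \<in> near y" "cyc_dist m y t = \<bar>int t - y'\<bar>"
    using cyc_dist_attained[OF assms(2,4)] unfolding near_def by blast
  have st: "int s \<in> near s" "int t \<in> near t" by (auto simp: near_def)
  have "lat_dist m (x, y) (s, t) = Min {\<bar>s' - x'\<bar> + \<bar>t' - y'\<bar> | x' y' s' t'.
      x' \<in> near x \<and> y' \<in> near y \<and> s' \<in> near s \<and> t' \<in> near t}"
    by (simp only: lat_dist_def near_def prod.case)
  moreover have "{\<bar>s' - x'\<bar> + \<bar>t' - y'\<bar> | x' y' s' t'.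
      x' \<in> near x \<and> y' \<in> near y \<and> s' \<in> near s \<and> t' \<in> near t} = F"
    unfolding F_def by (auto simp: image_iff) blast+
  moreover have "Min F = cyc_dist m x s + cyc_dist m y t"
  proof (rule Min_eqI[OF fin])
    show "cyc_dist m x s + cyc_dist m y t \<in> F"
      unfolding F_def using x' y' st by (intro image_eqI[of _ _ "(x', y', int s, int t)"]) auto
  next
    fix z assume "z \<in> F"
    then obtain x'' y'' s'' t'' where z: "z = \<bar>s'' - x''\<bar> + \<bar>t'' - y''\<bar>"
      "x'' \<in> near x" "y'' \<in> near y" "s'' \<in> near s" "t'' \<in> near t"
      unfolding F_def by auto
    then show "cyc_dist m x s + cyc_dist m y t \<le> z"
      using cyc_dist_le_abs[OF m md] by (simp add: add_mono)
  qed
  ultimately show ?thesis by simp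
qed

lemma cyc_dist_sym: "cyc_dist m x s = cyc_dist m s x"
  by (simp add: cyc_dist_def min.commute)

lemma cyc_dist_nonneg: "m > 0 \<Longrightarrow> 0 \<le> cyc_dist m x s"
  by (simp add: cyc_dist_def)

lemma cyc_dist_le_half: "m > 0 \<Longrightarrow> 2 * cyc_dist m x s \<le> int m"
proof -
  assume m: "m > 0"
  have "(int x - int s) mod int m = (if (int s - int x) mod int m = 0 then 0
      else int m - (int s - int x) mod int m)"
    using zmod_zminus1_eq_if[of "int s - int x" "int m"] by simp
  then show ?thesis using m by (auto simp: cyc_dist_def min_def)
qed

lemma cyc_dist_eq_0_iff:
  assumes "x \<in> {1..m}" "s \<in> {1..m}"
  shows "cyc_dist m x s = 0 \<longleftrightarrow> x = s"
proof
  assume *: "cyc_dist m x s = 0"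
  have "int m dvd int s - int x"
  proof -
    have "(int s - int x) mod int m = 0 \<or> (int x - int s) mod int m = 0"
      using * by (auto simp: cyc_dist_def min_def split: if_splits)
    then have "int m dvd int s - int x \<or> int m dvd int x - int s"
      by (auto simp: mod_eq_0_iff_dvd)
    then show ?thesis using dvd_minus_iff[of "int m" "int s - int x"] by auto
  qed
  moreover have "\<bar>int s - int x\<bar> < int m" using assms by auto
  ultimately show "x = s" using zdvd_imp_le[of "int m" "\<bar>int s - int x\<bar>"] by auto
qed (simp add: cyc_dist_def)

section \<open>Translations of the torus\<close>

definition cyc_shift :: "nat \<Rightarrow> nat \<Rightarrow> nat \<Rightarrow> nat" where
  "cyc_shift m a x = (x - 1 + a) mod m + 1"

lemma cyc_shift_in: "m > 0 \<Longrightarrow> cyc_shift m a x \<in> {1..m}"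
  by (simp add: cyc_shift_def Suc_leI)

lemma cyc_dist_shift:
  assumes "x \<in> {1..m}" "s \<in> {1..m}"
  shows "cyc_dist m (cyc_shift m a x) (cyc_shift m a s) = cyc_dist m x s"
proof -
  have *: "(int (cyc_shift m a s) - int (cyc_shift m a x)) mod int m = (int s - int x) mod int m"
    if "x \<in> {1..m}" "s \<in> {1..m}" for x s
  proof -
    have "int (cyc_shift m a s) - int (cyc_shift m a x)
        = (int s + int a - 1) mod int m - (int x + int a - 1) mod int m"
      using that by (simp add: cyc_shift_def zmod_int of_nat_diff)
    then show ?thesis by (simp add: mod_diff_eq)
  qed
  show ?thesis using *[OF assms] *[OF assms(2,1)] by (simp add: cyc_dist_def)
qed

text \<open>Injectivity comes from the isometry: points with equal images are at distance 0. An
  injective self-map of a finite set is onto.\<close>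

lemma cyc_shift_bij:
  assumes "m > 0"
  shows "bij_betw (cyc_shift m a) {1..m} {1..m}"
proof -
  have "inj_on (cyc_shift m a) {1..m}"
  proof (rule inj_onI)
    fix x y assume xy: "x \<in> {1..m}" "y \<in> {1..m}" "cyc_shift m a x = cyc_shift m a y"
    then have "cyc_dist m x y = 0"
      using cyc_dist_shift[OF xy(1,2), of a] by (simp add: cyc_dist_def)
    then show "x = y" using cyc_dist_eq_0_iff xy by blast
  qed
  moreover have "cyc_shift m a ` {1..m} \<subseteq> {1..m}" using cyc_shift_in[OF assms] by blast
  ultimately show ?thesis
    by (metis bij_betw_def endo_inj_surj finite_atLeastAtMost)
qed

text \<open>The summand \<open>m\<close> in the shift keeps the subtraction on naturals from
  truncating and vanishes modulo \<open>m\<close>.\<close>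

lemma cyc_shift_transitive:
  assumes "x \<in> {1..m}" "y \<in> {1..m}"
  shows "cyc_shift m (y + m - x) x = y"
proof -
  have "x - 1 + (y + m - x) = y - 1 + m" using assms by auto
  moreover have "y - 1 < m" using assms by auto
  then have "(y - 1 + m) mod m = y - 1" by simp
  ultimately show ?thesis using assms by (simp only: cyc_shift_def) auto
qed

text \<open>The symmetry behind \<open>card_loc_eq\<close>: it carries any node to any other, so the
  size of a local ball cannot depend on its centre.\<close>

lemma kl_nodes_transitive:
  assumes "u \<in> kl_nodes m" "v \<in> kl_nodes m"
  obtains \<tau> where "bij_betw \<tau> (kl_nodes m) (kl_nodes m)" "\<tau> u = v"
    "\<And>x y. x \<in> kl_nodes m \<Longrightarrow> y \<in> kl_nodes m \<Longrightarrow> lat_dist m (\<tau> x) (\<tau> y) = lat_dist m x y"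
proof -
  obtain u1 u2 v1 v2 where uv: "u = (u1, u2)" "v = (v1, v2)" by (metis surj_pair)
  have in_range: "u1 \<in> {1..m}" "u2 \<in> {1..m}" "v1 \<in> {1..m}" "v2 \<in> {1..m}"
    using assms by (auto simp: uv kl_nodes_def)
  have m: "m > 0" using in_range by auto
  define \<tau> where "\<tau> = map_prod (cyc_shift m (v1 + m - u1)) (cyc_shift m (v2 + m - u2))"
  have "bij_betw \<tau> (kl_nodes m) (kl_nodes m)"
    unfolding \<tau>_def kl_nodes_def by (intro bij_betw_map_prod cyc_shift_bij m)
  moreover have "\<tau> u = v"
    using cyc_shift_transitive in_range by (simp add: \<tau>_def uv)
  moreover have "lat_dist m (\<tau> x) (\<tau> y) = lat_dist m x y"
    if "x \<in> kl_nodes m" "y \<in> kl_nodes m" for x y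
  proof -
    obtain x1 x2 y1 y2 where xy: "x = (x1, x2)" "y = (y1, y2)" by (metis surj_pair)
    have "x1 \<in> {1..m}" "x2 \<in> {1..m}" "y1 \<in> {1..m}" "y2 \<in> {1..m}"
      using that by (auto simp: xy kl_nodes_def)
    then show ?thesis
      using cyc_shift_in[OF m] by (simp add: \<tau>_def xy lat_dist_eq_cyc_dist cyc_dist_shift del: atLeastAtMost_iff)
  qed
  ultimately show thesis using that by blast
qed

section \<open>Bounds on distances and on cyclic balls\<close>

lemma lat_dist_sym: "u \<in> kl_nodes m \<Longrightarrow> v \<in> kl_nodes m \<Longrightarrow> lat_dist m u v = lat_dist m v u"
  by (cases u; cases v) (auto simp: kl_nodes_def lat_dist_eq_cyc_dist cyc_dist_sym)

lemma lat_dist_self: "u \<in> kl_nodes m \<Longrightarrow> lat_dist m u u = 0"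
  by (cases u) (auto simp: kl_nodes_def lat_dist_eq_cyc_dist cyc_dist_def)

lemma lat_dist_le: "u \<in> kl_nodes m \<Longrightarrow> v \<in> kl_nodes m \<Longrightarrow> lat_dist m u v \<le> int m"
proof -
  assume uv: "u \<in> kl_nodes m" "v \<in> kl_nodes m"
  obtain x y s t where xy: "u = (x, y)" "v = (s, t)" by (metis surj_pair)
  have "m > 0" using uv by (auto simp: kl_nodes_def)
  then show ?thesis using uv cyc_dist_le_half[of m x s] cyc_dist_le_half[of m y t]
    by (auto simp: xy kl_nodes_def lat_dist_eq_cyc_dist)
qed

lemma lat_dist_pos:
  assumes "u \<in> kl_nodes m" "v \<in> kl_nodes m" "u \<noteq> v"
  shows "1 \<le> lat_dist m u v"
proof -
  obtain x y s t where xy: "u = (x, y)" "v = (s, t)" by (metis surj_pair)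
  have r: "x \<in> {1..m}" "y \<in> {1..m}" "s \<in> {1..m}" "t \<in> {1..m}"
    using assms by (auto simp: kl_nodes_def xy)
  have m: "m > 0" using r by auto
  have "cyc_dist m x s \<noteq> 0 \<or> cyc_dist m y t \<noteq> 0"
    using assms(3) cyc_dist_eq_0_iff r xy by blast
  then show ?thesis
    using cyc_dist_nonneg[OF m, of x s] cyc_dist_nonneg[OF m, of y t] r
    by (auto simp: xy lat_dist_eq_cyc_dist simp del: atLeastAtMost_iff)
qed

text \<open>Supplies the chain of local edges along which local balls grow linearly in
  \<open>loc_card_ge\<close>.\<close>

lemma lat_dist_vertical:
  assumes "x \<in> {1..m}" "y \<in> {1..m}" "Suc y \<in> {1..m}"
  shows "lat_dist m (x, y) (x, Suc y) \<le> 1"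
proof -
  have "cyc_dist m y (Suc y) \<le> 1"
    using cyc_dist_le_abs[of m "int (Suc y)" "int y" "Suc y" y] assms by auto
  then show ?thesis
    using assms lat_dist_eq_cyc_dist[of x m y x "Suc y"] cyc_dist_eq_0_iff[of x m x] by simp
qed

text \<open>Lists the cycle by the forward gap from \<open>x\<close>, so that sums and counts over
  it run over \<open>{..<m}\<close>.\<close>

lemma bij_betw_cyc_mod:
  assumes "x \<in> {1..m}"
  shows "bij_betw (\<lambda>s. nat ((int s - int x) mod int m)) {1..m} {..<m}"
proof -
  have m: "m > 0" using assms by auto
  have inj: "inj_on (\<lambda>s. nat ((int s - int x) mod int m)) {1..m}"
  proof (rule inj_onI)
    fix s t assume st: "s \<in> {1..m}" "t \<in> {1..m}"
      "nat ((int s - int x) mod int m) = nat ((int t - int x) mod int m)"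
    then have "(int s - int x) mod int m = (int t - int x) mod int m"
      using m by (metis nat_eq_iff2 pos_mod_sign of_nat_0_less_iff nat_0_le)
    then have "(int s - int x - (int t - int x)) mod int m = 0"
      by (metis mod_diff_cong diff_self mod_0)
    then have "cyc_dist m t s \<le> 0"
      by (simp add: cyc_dist_def)
    then show "s = t" using cyc_dist_nonneg[OF m, of t s] cyc_dist_eq_0_iff st by (metis order_antisym)
  qed
  have "(\<lambda>s. nat ((int s - int x) mod int m)) ` {1..m} \<subseteq> {..<m}"
    using m by (auto simp: nat_less_iff)
  moreover have "card ((\<lambda>s. nat ((int s - int x) mod int m)) ` {1..m}) = m"
    using inj by (simp add: card_image)
  ultimately have "(\<lambda>s. nat ((int s - int x) mod int m)) ` {1..m} = {..<m}"
    by (intro card_subset_eq) auto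
  then show ?thesis using inj by (simp add: bij_betw_def)
qed

lemma cyc_dist_eq_min:
  fixes x s :: nat
  assumes "m > 0"
  defines "j \<equiv> \<lambda>s. nat ((int s - int x) mod int m)"
  shows "cyc_dist m x s = (if j s = 0 then 0 else int (min (j s) (m - j s)))"
proof -
  have "(int x - int s) mod int m = (if (int s - int x) mod int m = 0 then 0
      else int m - (int s - int x) mod int m)"
    using zmod_zminus1_eq_if[of "int s - int x" "int m"] by simp
  moreover have "(int s - int x) mod int m \<ge> 0" "(int s - int x) mod int m < int m"
    using assms by auto
  ultimately show ?thesis by (auto simp: cyc_dist_def j_def min_def of_nat_diff)
qed

text \<open>The forward gaps of the ball lie in two arcs, \<open>{..p}\<close> and its reflection
  \<open>i \<mapsto> m - i\<close>, with at most \<open>p + 1\<close> gaps each.\<close>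

lemma card_cyc_ball_le:
  assumes "x \<in> {1..m}"
  shows "card {s \<in> {1..m}. cyc_dist m x s \<le> int p} \<le> 2 * p + 2"
proof -
  have m: "m > 0" using assms by auto
  define j where "j s = nat ((int s - int x) mod int m)" for s
  have bij: "bij_betw j {1..m} {..<m}" unfolding j_def by (rule bij_betw_cyc_mod[OF assms])
  have "card {s \<in> {1..m}. cyc_dist m x s \<le> int p} \<le> card ({..p} \<union> (\<lambda>i. m - i) ` {..p})"
  proof (rule card_inj_on_le)
    show "inj_on j {s \<in> {1..m}. cyc_dist m x s \<le> int p}"
      using bij by (auto simp: bij_betw_def intro: inj_on_subset)
    show "j ` {s \<in> {1..m}. cyc_dist m x s \<le> int p} \<subseteq> {..p} \<union> (\<lambda>i. m - i) ` {..p}"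
    proof safe
      fix s assume s: "s \<in> {1..m}" "cyc_dist m x s \<le> int p" "j s \<notin> (\<lambda>i. m - i) ` {..p}"
      have "j s < m" using bij_betwE[OF bij] s by auto
      then have "j s = m - (m - j s)" by simp
      then have "\<not> m - j s \<le> p" using s(3) by blast
      then show "j s \<le> p"
        using s(2) cyc_dist_eq_min[OF m, of x s] by (auto simp: j_def[symmetric] min_def split: if_splits)
    qed
  qed simp
  also have "\<dots> \<le> card {..p} + card ((\<lambda>i. m - i) ` {..p})" by (rule card_Un_le)
  also have "\<dots> \<le> 2 * p + 2" using card_image_le[of "{..p}" "\<lambda>i. m - i"] by simp
  finally show ?thesis .
qed

subsection \<open>The contact distribution\<close>

text \<open>Integral comparison on a unit interval: the right side is the integral of
  \<open>z powr (- s)\<close> from \<open>a\<close> to \<open>a + 1\<close>, and the integrand is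
  decreasing. The mean value theorem replaces the integral.\<close>

lemma powr_neg_le_diff:
  fixes s :: real
  assumes "0 \<le> s" "s < 1" "a \<ge> (1::real)"
  shows "(a + 1) powr (- s) \<le> ((a + 1) powr (1 - s) - a powr (1 - s)) / (1 - s)"
proof -
  have "\<exists>z>a. z < a + 1 \<and> (a + 1) powr (1 - s) - a powr (1 - s)
      = (a + 1 - a) * ((1 - s) * z powr (1 - s - 1))"
    using assms by (intro MVT2) (auto simp: has_real_derivative_powr[of _ "1 - s", simplified])
  then obtain z where z: "a < z" "z < a + 1"
    "(a + 1) powr (1 - s) - a powr (1 - s) = (1 - s) * z powr (- s)" by auto
  have "(a + 1) powr (- s) \<le> z powr (- s)"
    using z assms by (intro powr_mono2') auto
  then show ?thesis unfolding z(3) using assms by simp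
qed

lemma sum_powr_neg_le:
  fixes s :: real
  assumes "0 \<le> s" "s < 1"
  shows "(\<Sum>a=1..m. real a powr (- s)) \<le> real m powr (1 - s) / (1 - s)"
proof (induction m)
  case 0
  then show ?case by simp
next
  case (Suc m)
  show ?case
  proof (cases "m = 0")
    case True
    then show ?thesis using assms by (simp add: field_simps)
  next
    case False
    then have "real (Suc m) powr (- s) \<le> (real (Suc m) powr (1 - s) - real m powr (1 - s)) / (1 - s)"
      using powr_neg_le_diff[OF assms, of "real m"] by (simp add: add.commute)
    then show ?thesis using Suc.IH by (simp add: diff_divide_distrib)
  qed
qed

text \<open>A gap \<open>i > 0\<close> contributes at most
  \<open>i powr (- s) + (m - i) powr (- s)\<close>, which gives two one-sided power sums; the point
  \<open>x\<close> itself contributes 1. Each of the three parts is at most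
  \<open>m powr (1 - s) / (1 - s)\<close>.\<close>

lemma sum_cyc_dist_powr_le:
  fixes s :: real
  assumes "x \<in> {1..m}" "0 \<le> s" "s < 1"
  shows "(\<Sum>t\<in>{1..m}. max 1 (real_of_int (cyc_dist m x t)) powr (- s))
      \<le> 3 / (1 - s) * real m powr (1 - s)"
proof -
  have m: "m > 0" using assms by auto
  define g where "g i = max 1 (if i = 0 then 0 else real (min i (m - i))) powr (- s)" for i
  have "(\<Sum>t\<in>{1..m}. max 1 (real_of_int (cyc_dist m x t)) powr (- s))
      = (\<Sum>t\<in>{1..m}. g (nat ((int t - int x) mod int m)))"
    by (rule sum.cong) (auto simp: g_def cyc_dist_eq_min[OF m] simp del: of_nat_min)
  also have "\<dots> = (\<Sum>i<m. g i)"
    by (rule sum.reindex_bij_betw[OF bij_betw_cyc_mod[OF assms(1)]])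
  also have "{..<m} = insert 0 {1..m-1}" using m by auto
  also have "sum g \<dots> = 1 + (\<Sum>i\<in>{1..m-1}. g i)"
    by (simp add: g_def)
  also have "(\<Sum>i\<in>{1..m-1}. g i) \<le> (\<Sum>i\<in>{1..m-1}. real i powr (-s) + real (m - i) powr (- s))"
    by (rule sum_mono) (auto simp: g_def min_def max_def)
  also have "\<dots> = (\<Sum>i\<in>{1..m-1}. real i powr (-s)) + (\<Sum>i\<in>{1..m-1}. real (m - i) powr (- s))"
    by (rule sum.distrib)
  also have "(\<Sum>i\<in>{1..m-1}. real (m - i) powr (- s)) = (\<Sum>i\<in>{1..m-1}. real i powr (-s))"
    by (rule sum.reindex_bij_witness[of _ "\<lambda>i. m - i" "\<lambda>i. m - i"]) auto
  also have "(\<Sum>i\<in>{1..m-1}. real i powr (-s)) \<le> (\<Sum>i\<in>{1..m}. real i powr (-s))"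
    by (rule sum_mono2) auto
  also have "\<dots> \<le> real m powr (1 - s) / (1 - s)" by (rule sum_powr_neg_le[OF assms(2,3)])
  finally have *: "(\<Sum>t\<in>{1..m}. max 1 (real_of_int (cyc_dist m x t)) powr (- s))
      \<le> 1 + (real m powr (1 - s) / (1 - s) + real m powr (1 - s) / (1 - s))" by simp
  have "1 \<le> real m powr (1 - s)" using m assms by (simp add: ge_one_powr_ge_zero)
  moreover have "real m powr (1 - s) * (1 - s) \<le> real m powr (1 - s)"
    using assms by (intro mult_left_le) auto
  ultimately have "1 \<le> real m powr (1 - s) / (1 - s)" using assms by (simp add: field_simps)
  then show ?thesis using * by simp
qed

lemma finite_kl_nodes [simp]: "finite (kl_nodes m)"
  by (simp add: kl_nodes_def)

lemma card_kl_nodes [simp]: "card (kl_nodes m) = m\<^sup>2"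
  by (simp add: kl_nodes_def power2_eq_square)

text \<open>Since \<open>d \<ge> max a b\<close> for \<open>d = a + b\<close>, the sum over the torus is dominated by a product of two
  one-dimensional sums.\<close>
lemma sum_lat_dist_powr_le:
  fixes s :: real
  assumes "u \<in> kl_nodes m" "0 \<le> s" "s < 1"
  shows "(\<Sum>v\<in>kl_nodes m - {u}. real_of_int (lat_dist m u v) powr (- (2 * s)))
      \<le> (3 / (1 - s))\<^sup>2 * real m powr (2 - 2 * s)"
proof -
  obtain x y where u: "u = (x, y)" by (metis surj_pair)
  have xy: "x \<in> {1..m}" "y \<in> {1..m}" using assms by (auto simp: u kl_nodes_def)
  have m: "m > 0" using xy by auto
  define A where "A x t = max 1 (real_of_int (cyc_dist m x t)) powr (- s)" for x t
  have "(\<Sum>v\<in>kl_nodes m - {u}. real_of_int (lat_dist m u v) powr (- (2 * s)))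
      \<le> (\<Sum>v\<in>kl_nodes m - {u}. A x (fst v) * A y (snd v))"
  proof (rule sum_mono)
    fix v assume v: "v \<in> kl_nodes m - {u}"
    obtain a b where ab: "v = (a, b)" by (metis surj_pair)
    have d1: "1 \<le> lat_dist m u v" using lat_dist_pos[of u m v] v assms(1) by auto
    have eq: "lat_dist m u v = cyc_dist m x a + cyc_dist m y b"
      using v xy unfolding u ab by (intro lat_dist_eq_cyc_dist) (auto simp: kl_nodes_def)
    define d where "d = real_of_int (lat_dist m u v)"
    have le: "max 1 (real_of_int (cyc_dist m x a)) \<le> d" "max 1 (real_of_int (cyc_dist m y b)) \<le> d"
      using d1 eq cyc_dist_nonneg[OF m, of x a] cyc_dist_nonneg[OF m, of y b] by (auto simp: d_def)
    have "d powr (- (2 * s)) = d powr (- s) * d powr (- s)"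
      by (simp add: powr_add[symmetric])
    also have "\<dots> \<le> A x a * A y b"
      unfolding A_def using le assms by (intro mult_mono powr_mono2') auto
    finally show "real_of_int (lat_dist m u v) powr (- (2 * s)) \<le> A x (fst v) * A y (snd v)"
      by (simp add: ab d_def)
  qed
  also have "\<dots> \<le> (\<Sum>v\<in>kl_nodes m. A x (fst v) * A y (snd v))"
    by (rule sum_mono2) (auto simp: A_def)
  also have "\<dots> = (\<Sum>a\<in>{1..m}. A x a) * (\<Sum>b\<in>{1..m}. A y b)"
    unfolding kl_nodes_def sum_product sum.cartesian_product by (simp add: case_prod_unfold)
  also have "\<dots> \<le> (3 / (1 - s) * real m powr (1 - s)) * (3 / (1 - s) * real m powr (1 - s))"
    unfolding A_def using assms by (intro mult_mono sum_cyc_dist_powr_le xy sum_nonneg) auto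
  also have "\<dots> = (3 / (1 - s))\<^sup>2 * (real m powr (1 - s) * real m powr (1 - s))"
    by (simp add: power2_eq_square)
  also have "real m powr (1 - s) * real m powr (1 - s) = real m powr (2 - 2 * s)"
    by (simp add: powr_add[symmetric])
  finally show ?thesis .
qed

section \<open>The normalising constant and hitting probabilities\<close>

lemma lr_weight_nonneg: "0 \<le> lr_weight m r u v"
  by (simp add: lr_weight_def)

lemma lr_weight_ge:
  assumes "u \<in> kl_nodes m" "v \<in> kl_nodes m" "u \<noteq> v" "0 \<le> r"
  shows "real m powr (- r) \<le> lr_weight m r u v"
proof -
  have m: "m > 0" using assms by (auto simp: kl_nodes_def)
  have "real m powr (- r) \<le> real_of_int (lat_dist m u v) powr (- r)"
    using lat_dist_le[OF assms(1,2)] lat_dist_pos[OF assms(1-3)] assms(4)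
    by (intro powr_mono2') auto
  then show ?thesis using m by (auto simp: lr_weight_def)
qed

lemma lr_weight_self: "u \<in> kl_nodes m \<Longrightarrow> lr_weight m r u u = (if r = 0 then 1 else 0)"
  by (simp add: lr_weight_def lat_dist_self)

lemma square_mult_powr: "m > 0 \<Longrightarrow> (real m)\<^sup>2 * real m powr e = real m powr (2 + e)"
  by (simp add: powr_add)

text \<open>The diameter is at most \<open>m\<close>, so each of the \<open>m\<^sup>2 - 1\<close>
  other nodes weighs at least \<open>m powr (- r)\<close>, and \<open>m \<ge> 2\<close> makes their
  number at least \<open>m\<^sup>2 / 2\<close>.\<close>

lemma lr_total_ge:
  assumes "u \<in> kl_nodes m" "0 \<le> r" "m \<ge> 2"
  shows "real m powr (2 - r) / 2 \<le> lr_total m r u"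
proof -
  have "real m powr (2 - r) / 2 = (real m)\<^sup>2 / 2 * real m powr (- r)"
    using square_mult_powr[of m "- r"] assms by simp
  also have "\<dots> \<le> ((real m)\<^sup>2 - 1) * real m powr (- r)"
  proof (rule mult_right_mono)
    have "(2::real)\<^sup>2 \<le> (real m)\<^sup>2" using assms by (intro power_mono) auto
    then show "(real m)\<^sup>2 / 2 \<le> (real m)\<^sup>2 - 1" by simp
  qed auto
  also have "\<dots> = (\<Sum>v\<in>kl_nodes m - {u}. real m powr (- r))"
    using assms by (simp add: of_nat_diff)
  also have "\<dots> \<le> (\<Sum>v\<in>kl_nodes m - {u}. lr_weight m r u v)"
    using assms by (intro sum_mono lr_weight_ge) auto
  also have "\<dots> \<le> lr_total m r u"
    unfolding lr_total_def by (rule sum_mono2) (auto simp: lr_weight_nonneg)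
  finally show ?thesis .
qed

lemma lr_total_pos: "u \<in> kl_nodes m \<Longrightarrow> 0 \<le> r \<Longrightarrow> m \<ge> 2 \<Longrightarrow> 0 < lr_total m r u"
  using lr_total_ge[of u m r] by (smt (verit) half_gt_zero of_nat_0_less_iff powr_gt_zero zero_less_numeral order_less_le_trans)

text \<open>The lattice sum is applied with \<open>s = r / 2\<close>, which is where
  \<open>r < 2\<close> enters. The case \<open>r = 0\<close> is separate because there
  \<open>u\<close> itself has weight 1.\<close>

lemma lr_total_le:
  assumes "u \<in> kl_nodes m" "0 \<le> r" "r < 2"
  shows "lr_total m r u \<le> (6 / (2 - r))\<^sup>2 * real m powr (2 - r)"
proof (cases "r = 0")
  case True
  have "m > 0" using assms by (auto simp: kl_nodes_def)
  then show ?thesis using True by (simp add: lr_total_def lr_weight_def)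
next
  case False
  have "lr_total m r u = lr_weight m r u u + (\<Sum>v\<in>kl_nodes m - {u}. lr_weight m r u v)"
    unfolding lr_total_def using assms by (intro sum.remove) auto
  also have "\<dots> = (\<Sum>v\<in>kl_nodes m - {u}. real_of_int (lat_dist m u v) powr (- (2 * (r / 2))))"
    using False assms by (simp add: lr_weight_self) (simp add: lr_weight_def)
  also have "\<dots> \<le> (3 / (1 - r / 2))\<^sup>2 * real m powr (2 - 2 * (r / 2))"
    using assms by (intro sum_lat_dist_powr_le) auto
  also have "3 / (1 - r / 2) = 6 / (2 - r)" using assms by (simp add: field_simps)
  finally show ?thesis by simp
qed

lemma pmf_contact:
  assumes "u \<in> kl_nodes m" "0 \<le> r" "m \<ge> 2"
  shows "pmf (contact_pmf m r u) v = (if v \<in> kl_nodes m then lr_weight m r u v / lr_total m r u else 0)"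
proof -
  have pos: "0 < lr_total m r u" by (rule lr_total_pos[OF assms])
  define f where "f v = (if v \<in> kl_nodes m then lr_weight m r u v / lr_total m r u else 0)" for v
  have f0: "0 \<le> f v" for v using pos by (simp add: f_def lr_weight_nonneg)
  have "(\<integral>\<^sup>+ v. ennreal (f v) \<partial>count_space UNIV) = (\<Sum>v\<in>kl_nodes m. ennreal (f v))"
    by (rule nn_integral_count_space') (auto simp: f_def)
  also have "\<dots> = ennreal (\<Sum>v\<in>kl_nodes m. f v)"
    by (rule sum_ennreal) (use f0 in auto)
  also have "(\<Sum>v\<in>kl_nodes m. f v) = 1"
    using pos by (simp add: f_def sum_divide_distrib[symmetric] lr_total_def[symmetric])
  finally have "pmf (embed_pmf f) v = f v" by (intro pmf_embed_pmf) (auto simp: f0)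
  then show ?thesis using pos unfolding contact_pmf_def f_def by simp
qed

lemma set_pmf_contact:
  assumes "u \<in> kl_nodes m" "0 \<le> r" "m \<ge> 2"
  shows "set_pmf (contact_pmf m r u) \<subseteq> kl_nodes m"
  using pmf_contact[OF assms] by (auto simp: set_pmf_eq)

text \<open>Each node other than \<open>u\<close> has at least the smallest weight divided by the
  upper bound for the total. The \<open>- 1\<close> discounts \<open>u\<close>, whose weight is 0
  when \<open>r > 0\<close>.\<close>

lemma contact_prob_ge:
  assumes "u \<in> kl_nodes m" "0 \<le> r" "r < 2" "m \<ge> 2" "V \<subseteq> kl_nodes m"
  shows "((2 - r) / 6)\<^sup>2 * (real (card V) - 1) / (real m)\<^sup>2 \<le> measure_pmf.prob (contact_pmf m r u) V"
proof -
  define c where "c = ((2 - r) / 6)\<^sup>2 / (real m)\<^sup>2"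
  have finV: "finite V" using finite_subset[OF assms(5)] by simp
  have ge: "c \<le> pmf (contact_pmf m r u) v" if "v \<in> V - {u}" for v
  proof -
    have v: "v \<in> kl_nodes m" "u \<noteq> v" using that assms by auto
    have "real m powr (2 - r) = (real m)\<^sup>2 * real m powr (- r)"
      using square_mult_powr[of m "- r"] assms by simp
    then have "c = real m powr (- r) / ((6 / (2 - r))\<^sup>2 * real m powr (2 - r))"
      using assms by (simp add: c_def power_divide)
    also have "\<dots> \<le> lr_weight m r u v / lr_total m r u"
      using lr_weight_ge[OF assms(1) v(1,2) assms(2)] lr_total_le[OF assms(1-3)]
        lr_total_pos[OF assms(1,2,4)] by (intro frac_le) (auto simp: lr_weight_nonneg)
    finally show ?thesis using pmf_contact[OF assms(1,2,4)] v by simp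
  qed
  have "((2 - r) / 6)\<^sup>2 * (real (card V) - 1) / (real m)\<^sup>2 = (real (card V) - 1) * c"
    by (simp add: c_def)
  also have "\<dots> \<le> real (card (V - {u})) * c"
  proof (rule mult_right_mono)
    show "real (card V) - 1 \<le> real (card (V - {u}))"
      using card_Diff1_le[of V u] finV by (cases "u \<in> V") (auto simp: card_Diff_singleton)
  qed (auto simp: c_def)
  also have "\<dots> \<le> (\<Sum>v\<in>V - {u}. pmf (contact_pmf m r u) v)"
    using sum_mono[of "V - {u}" "\<lambda>_. c" "pmf (contact_pmf m r u)"] ge by simp
  also have "\<dots> \<le> (\<Sum>v\<in>V. pmf (contact_pmf m r u) v)"
    using finV by (intro sum_mono2) auto
  also have "\<dots> = measure_pmf.prob (contact_pmf m r u) V"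
    using finV by (simp add: measure_measure_pmf_finite)
  finally show ?thesis .
qed

text \<open>The decay exponent comes from \<open>d\<^bsup>-r\<^esup> \<le> D\<^bsup>-r\<^esup> + D\<^bsup>k - r\<^esup> d\<^bsup>-k\<^esup>\<close> with \<open>k = 1 + r/2\<close>, strictly between \<open>r\<close> and \<open>2\<close>,
  at the cutoff \<open>D = x\<^bsup>1/k\<^esup> m\<close>, where \<open>x\<close> is the density of \<open>h\<close>.\<close>
lemma contact_expectation_le:
  fixes h :: "node \<Rightarrow> real"
  assumes u: "u \<in> kl_nodes m" and r: "0 \<le> r" "r < 2" and m: "m \<ge> 2"
    and h: "\<And>v. v \<in> kl_nodes m \<Longrightarrow> 0 \<le> h v" "\<And>v. v \<in> kl_nodes m \<Longrightarrow> h v \<le> 1"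
  shows "(\<Sum>v\<in>kl_nodes m. h v * pmf (contact_pmf m r u) v)
      \<le> 2 * (1 + (12 / (2 - r))\<^sup>2) * ((\<Sum>v\<in>kl_nodes m. h v) / (real m)\<^sup>2) powr ((2 - r) / (2 + r))"
proof -
  define H where "H = (\<Sum>v\<in>kl_nodes m. h v)"
  define x where "x = H / (real m)\<^sup>2"
  define K where "K = (12 / (2 - r))\<^sup>2"
  define \<kappa> where "\<kappa> = 1 + r / 2"
  have \<gamma>: "(2 - r) / (2 + r) = 1 - r / \<kappa>" using r by (simp add: \<kappa>_def field_simps)
  have \<kappa>: "\<kappa> > 0" "r < \<kappa>" "\<kappa> < 2" using r by (auto simp: \<kappa>_def)
  have H0: "0 \<le> H" unfolding H_def by (rule sum_nonneg) (use h in auto)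
  have K0: "0 \<le> K" by (simp add: K_def)
  have pmf: "pmf (contact_pmf m r u) v = lr_weight m r u v / lr_total m r u" if "v \<in> kl_nodes m" for v
    using pmf_contact[OF u r(1) m] that by simp
  \<comment> \<open>\<open>H = 0\<close> is split off so that \<open>x\<close> and the cutoff
    \<open>D\<close> are positive, and \<open>r = 0\<close> because \<open>u\<close> then has weight
    1 rather than 0.\<close>
  consider "H = 0" | "H > 0" "r = 0" | "H > 0" "r > 0" using H0 r by fastforce
  then have "(\<Sum>v\<in>kl_nodes m. h v * pmf (contact_pmf m r u) v) \<le> 2 * (1 + K) * x powr (1 - r / \<kappa>)"
  proof cases
    case 1
    then have "\<forall>v\<in>kl_nodes m. h v = 0"
      unfolding H_def using h by (subst (asm) sum_nonneg_eq_0_iff) auto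
    then have "(\<Sum>v\<in>kl_nodes m. h v * pmf (contact_pmf m r u) v) = 0" by simp
    then show ?thesis using K0 by simp
  next
    case 2
    have "lr_total m r u = (real m)\<^sup>2" using 2 by (simp add: lr_total_def lr_weight_def)
    then have "(\<Sum>v\<in>kl_nodes m. h v * pmf (contact_pmf m r u) v) = (\<Sum>v\<in>kl_nodes m. h v / (real m)\<^sup>2)"
      using 2 by (intro sum.cong refl) (simp add: pmf[unfolded 2] lr_weight_def)
    also have "\<dots> = x" by (simp add: sum_divide_distrib x_def H_def)
    also have "\<dots> \<le> 2 * (1 + K) * x"
      using K0 mult_right_mono[of 1 "2 * (1 + K)" x] 2 m by (auto simp: x_def)
    finally show ?thesis using 2 m by (simp add: x_def)
  next
    case 3
    have x0: "x > 0" using 3 m by (simp add: x_def)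
    have m0: "real m > 0" using m by simp
    define D where "D = x powr (1 / \<kappa>) * real m"
    have D0: "D > 0" using x0 m0 by (simp add: D_def)
    have D_powr: "D powr e = x powr (e / \<kappa>) * real m powr e" for e
      using x0 m0 by (simp add: D_def powr_mult powr_powr)
    \<comment> \<open>From the cutoff on the first term dominates, below it the second.\<close>
    have pt: "d powr (- r) \<le> D powr (- r) + D powr (\<kappa> - r) * d powr (- \<kappa>)" if "d \<ge> 1" for d :: real
    proof (cases "d \<ge> D")
      case True
      then have "d powr (- r) \<le> D powr (- r)" using D0 r by (intro powr_mono2') auto
      then show ?thesis by (simp add: add_increasing2)
    next
      case False
      have "d powr (- r) = d powr (\<kappa> - r) * d powr (- \<kappa>)" by (simp add: powr_add[symmetric])
      also have "\<dots> \<le> D powr (\<kappa> - r) * d powr (- \<kappa>)"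
        using False that \<kappa> by (intro mult_right_mono powr_mono2) auto
      finally show ?thesis by (simp add: add_increasing)
    qed
    have "(\<Sum>v\<in>kl_nodes m. h v * lr_weight m r u v)
        = h u * lr_weight m r u u + (\<Sum>v\<in>kl_nodes m - {u}. h v * lr_weight m r u v)"
      using u by (intro sum.remove) auto
    also have "\<dots> = (\<Sum>v\<in>kl_nodes m - {u}. h v * real_of_int (lat_dist m u v) powr (- r))"
      using 3 u by (simp add: lr_weight_self) (simp add: lr_weight_def)
    also have "\<dots> \<le> (\<Sum>v\<in>kl_nodes m - {u}. h v * D powr (- r)
        + D powr (\<kappa> - r) * real_of_int (lat_dist m u v) powr (- \<kappa>))"
    proof (rule sum_mono)
      fix v assume v: "v \<in> kl_nodes m - {u}"
      define d where "d = real_of_int (lat_dist m u v)"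
      have "d \<ge> 1" using lat_dist_pos[of u m v] u v by (auto simp: d_def)
      then have "h v * d powr (- r) \<le> h v * (D powr (- r) + D powr (\<kappa> - r) * d powr (- \<kappa>))"
        using pt h v by (intro mult_left_mono) auto
      \<comment> \<open>The first term keeps \<open>h\<close>, whose sum is at most
        \<open>H\<close>. In the second, \<open>h \<le> 1\<close> is used up, leaving the full
        lattice sum at exponent \<open>\<kappa> < 2\<close>.\<close>
      also have "\<dots> \<le> h v * D powr (- r) + 1 * (D powr (\<kappa> - r) * d powr (- \<kappa>))"
        unfolding distrib_left using h v by (intro add_left_mono mult_right_mono) auto
      finally show "h v * real_of_int (lat_dist m u v) powr (- r)
        \<le> h v * D powr (- r) + D powr (\<kappa> - r) * real_of_int (lat_dist m u v) powr (- \<kappa>)"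
        by (simp add: d_def)
    qed
    also have "\<dots> = (\<Sum>v\<in>kl_nodes m - {u}. h v) * D powr (- r)
        + D powr (\<kappa> - r) * (\<Sum>v\<in>kl_nodes m - {u}. real_of_int (lat_dist m u v) powr (- (2 * (\<kappa> / 2))))"
      by (simp add: sum.distrib sum_distrib_left sum_distrib_right)
    also have "\<dots> \<le> H * D powr (- r) + D powr (\<kappa> - r) * ((3 / (1 - \<kappa> / 2))\<^sup>2 * real m powr (2 - 2 * (\<kappa> / 2)))"
      unfolding H_def using \<kappa> h by (intro add_mono mult_left_mono mult_right_mono sum_mono2 sum_lat_dist_powr_le u) auto
    also have "3 / (1 - \<kappa> / 2) = 12 / (2 - r)" using r by (simp add: \<kappa>_def field_simps)
    \<comment> \<open>The choice of \<open>D\<close> balances the two terms: both are multiples of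
      \<open>x powr (1 - r / \<kappa>) * m powr (2 - r)\<close>.\<close>
    also have "H * D powr (- r) + D powr (\<kappa> - r) * ((12 / (2 - r))\<^sup>2 * real m powr (2 - 2 * (\<kappa> / 2)))
       = (1 + K) * (x powr (1 - r / \<kappa>) * real m powr (2 - r))"
    proof -
      have "H * D powr (- r) = (x * x powr (- r / \<kappa>)) * ((real m)\<^sup>2 * real m powr (- r))"
        using m0 by (simp add: D_powr x_def)
      also have "x * x powr (- r / \<kappa>) = x powr (1 - r / \<kappa>)"
        using x0 powr_mult_base[of x "- r / \<kappa>"] by simp
      also have "(real m)\<^sup>2 * real m powr (- r) = real m powr (2 - r)"
        using square_mult_powr[of m "- r"] m by simp
      finally have 1: "H * D powr (- r) = x powr (1 - r / \<kappa>) * real m powr (2 - r)" .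
      have "(\<kappa> - r) / \<kappa> = 1 - r / \<kappa>" using \<kappa> by (simp add: field_simps)
      then have 2: "D powr (\<kappa> - r) * real m powr (2 - \<kappa>) = x powr (1 - r / \<kappa>) * real m powr (2 - r)"
        by (simp add: D_powr mult.assoc powr_add[symmetric])
      show ?thesis using 1 2 by (simp add: K_def algebra_simps)
    qed
    finally have W: "(\<Sum>v\<in>kl_nodes m. h v * lr_weight m r u v)
        \<le> (1 + K) * (x powr (1 - r / \<kappa>) * real m powr (2 - r))" .
    have "(\<Sum>v\<in>kl_nodes m. h v * pmf (contact_pmf m r u) v)
        = (\<Sum>v\<in>kl_nodes m. h v * lr_weight m r u v) / lr_total m r u"
      by (simp add: pmf sum_divide_distrib)
    also have "\<dots> \<le> ((1 + K) * (x powr (1 - r / \<kappa>) * real m powr (2 - r))) / (real m powr (2 - r) / 2)"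
      using W lr_total_ge[OF u r(1) m] m0 K0 by (intro frac_le) auto
    also have "\<dots> = 2 * (1 + K) * x powr (1 - r / \<kappa>)"
      using m0 by (simp add: field_simps)
    finally show ?thesis .
  qed
  then show ?thesis by (simp add: \<gamma> K_def x_def H_def)
qed

subsection \<open>Growth of balls\<close>

locale kleinberg =
  fixes m p q :: nat and r :: real
  assumes m2: "m \<ge> 2" and p1: "p \<ge> 1" and q1: "q \<ge> 1" and r0: "0 \<le> r" and r2: "r < 2"
begin

text \<open>The neighbourhood is closed, so that \<open>loc\<close> and \<open>reach\<close>
  increase with the radius.\<close>

definition nbr :: "node \<Rightarrow> node set" where
  "nbr x = {z \<in> kl_nodes m. lat_dist m x z \<le> int p}"

primrec loc :: "node \<Rightarrow> nat \<Rightarrow> node set" where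
  "loc x 0 = {x}"
| "loc x (Suc k) = (\<Union>y\<in>loc x k. nbr y)"

lemma origin_in: "(1, 1) \<in> kl_nodes m"
  using m2 by (simp add: kl_nodes_def)

lemma nbr_self: "x \<in> kl_nodes m \<Longrightarrow> x \<in> nbr x"
  by (simp add: nbr_def lat_dist_self)

lemma nbr_sym: "x \<in> kl_nodes m \<Longrightarrow> y \<in> nbr x \<Longrightarrow> x \<in> nbr y"
  using lat_dist_sym by (auto simp: nbr_def)

lemma nbr_subset: "nbr x \<subseteq> kl_nodes m"
  by (auto simp: nbr_def)

lemma loc_subset: "x \<in> kl_nodes m \<Longrightarrow> loc x k \<subseteq> kl_nodes m"
  by (cases k) (use nbr_subset in auto)

lemma finite_loc [simp]: "finite (loc x k)"
  by (induction k) (auto intro: finite_subset[OF nbr_subset])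

lemma loc_mono:
  assumes "x \<in> kl_nodes m" "k \<le> l"
  shows "loc x k \<subseteq> loc x l"
  using assms(2)
proof (induction l rule: dec_induct)
  case (step l)
  have "loc x l \<subseteq> loc x (Suc l)"
  proof
    fix z assume z: "z \<in> loc x l"
    then have "z \<in> nbr z" using loc_subset[OF assms(1), of l] by (intro nbr_self) blast
    then show "z \<in> loc x (Suc l)" using z unfolding loc.simps by blast
  qed
  then show ?case using step by blast
qed simp

lemma loc_Suc_left: "loc x (Suc k) = (\<Union>y\<in>nbr x. loc y k)"
  by (induction k) auto

lemma loc_sym:
  "x \<in> kl_nodes m \<Longrightarrow> y \<in> loc x k \<Longrightarrow> x \<in> loc y k"
proof (induction k arbitrary: x y)
  case (Suc k)
  obtain z where z: "z \<in> loc x k" "y \<in> nbr z" using Suc.prems by auto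
  have zV: "z \<in> kl_nodes m" using z loc_subset Suc.prems by blast
  have "x \<in> loc z k" using Suc.IH[OF Suc.prems(1) z(1)] .
  then show ?case using nbr_sym[OF zV z(2)] by (subst loc_Suc_left) blast
qed auto

text \<open>A translation taking \<open>u\<close> to \<open>v\<close> is an isometry, hence carries
  neighbourhoods to neighbourhoods and, by induction, local balls to local balls.\<close>

lemma card_loc_eq:
  assumes "u \<in> kl_nodes m" "v \<in> kl_nodes m"
  shows "card (loc u k) = card (loc v k)"
proof -
  obtain \<tau> where bij: "bij_betw \<tau> (kl_nodes m) (kl_nodes m)" and uv: "\<tau> u = v"
    and d: "\<And>x y. x \<in> kl_nodes m \<Longrightarrow> y \<in> kl_nodes m \<Longrightarrow> lat_dist m (\<tau> x) (\<tau> y) = lat_dist m x y"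
    using kl_nodes_transitive[OF assms] by blast
  have nbr: "nbr (\<tau> x) = \<tau> ` nbr x" if "x \<in> kl_nodes m" for x
  proof
    show "nbr (\<tau> x) \<subseteq> \<tau> ` nbr x"
    proof
      fix z assume z: "z \<in> nbr (\<tau> x)"
      then have "z \<in> \<tau> ` kl_nodes m" using bij nbr_subset[of "\<tau> x"] by (auto simp: bij_betw_def)
      then obtain w where "w \<in> kl_nodes m" "z = \<tau> w" by blast
      then show "z \<in> \<tau> ` nbr x" using z d that by (auto simp: nbr_def)
    qed
    show "\<tau> ` nbr x \<subseteq> nbr (\<tau> x)"
    proof
      fix z assume "z \<in> \<tau> ` nbr x"
      then obtain w where w: "w \<in> kl_nodes m" "lat_dist m x w \<le> int p" "z = \<tau> w"
        unfolding nbr_def by blast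
      then show "z \<in> nbr (\<tau> x)" using d[OF that w(1)] bij_betwE[OF bij] by (simp add: nbr_def)
    qed
  qed
  have "loc v k = \<tau> ` loc u k"
  proof (induction k)
    case (Suc k)
    have "loc v (Suc k) = (\<Union>y\<in>loc u k. nbr (\<tau> y))" using Suc by simp
    also have "\<dots> = (\<Union>y\<in>loc u k. \<tau> ` nbr y)"
      using nbr loc_subset[OF assms(1), of k] by (intro SUP_cong refl) blast
    finally show ?case by (simp add: image_UN)
  qed (simp add: uv)
  moreover have "inj_on \<tau> (loc u k)"
    using bij loc_subset[OF assms(1)] by (auto simp: bij_betw_def intro: inj_on_subset)
  ultimately show ?thesis by (simp add: card_image)
qed

definition loc_card :: "nat \<Rightarrow> nat" where "loc_card k = card (loc (1, 1) k)"

lemma card_loc: "x \<in> kl_nodes m \<Longrightarrow> card (loc x k) = loc_card k"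
  unfolding loc_card_def using card_loc_eq origin_in by blast

lemma loc_card_0 [simp]: "loc_card 0 = 1" by (simp add: loc_card_def)

lemma loc_card_mono: "k \<le> l \<Longrightarrow> loc_card k \<le> loc_card l"
  unfolding loc_card_def using loc_mono origin_in by (intro card_mono) auto

lemma loc_card_Suc_le: "loc_card (Suc k) \<le> loc_card 1 * loc_card k"
proof -
  have "loc_card (Suc k) \<le> (\<Sum>y\<in>loc (1, 1) k. card (nbr y))"
    unfolding loc_card_def loc.simps by (rule card_UN_le) simp
  also have "\<dots> = (\<Sum>y\<in>loc (1, 1) k. loc_card 1)"
  proof (rule sum.cong)
    fix y assume "y \<in> loc (1, 1) k"
    then have "y \<in> kl_nodes m" using loc_subset origin_in by blast
    then show "card (nbr y) = loc_card 1" using card_loc[of y 1] by simp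
  qed simp
  finally show ?thesis by (simp add: loc_card_def mult.commute)
qed

lemma loc_card_1_le: "loc_card 1 \<le> (2 * p + 2)\<^sup>2"
proof -
  define c where "c = {s \<in> {1..m}. cyc_dist m 1 s \<le> int p}"
  have "loc (1, 1) 1 \<subseteq> c \<times> c"
  proof
    fix z assume z: "z \<in> loc (1, 1) 1"
    obtain s t where st: "z = (s, t)" by (metis surj_pair)
    have "s \<in> {1..m}" "t \<in> {1..m}" "lat_dist m (1, 1) (s, t) \<le> int p"
      using z by (auto simp: st nbr_def kl_nodes_def)
    then show "z \<in> c \<times> c"
      using lat_dist_eq_cyc_dist[of 1 m 1 s t] m2 cyc_dist_nonneg[of m 1 s] cyc_dist_nonneg[of m 1 t]
      by (auto simp: st c_def)
  qed
  then have "loc_card 1 \<le> card (c \<times> c)" unfolding loc_card_def by (intro card_mono) (auto simp: c_def)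
  also have "\<dots> = (card c)\<^sup>2" by (simp add: power2_eq_square card_cartesian_product)
  also have "\<dots> \<le> (2 * p + 2)\<^sup>2"
    unfolding c_def using m2 by (intro power_mono card_cyc_ball_le) auto
  finally show ?thesis .
qed

text \<open>The ball contains a vertical segment through its centre. Linear growth suffices later,
  where a ball of radius of order \<open>T\<close> has to outweigh a factor
  \<open>1 / sqrt T\<close>.\<close>

lemma loc_card_ge: "min (Suc k) m \<le> loc_card k"
proof -
  have col: "y \<le> Suc k \<Longrightarrow> 1 \<le> y \<Longrightarrow> y \<le> m \<Longrightarrow> (1, y) \<in> loc (1, 1) k" for y
  proof (induction k arbitrary: y)
    case (Suc k)
    show ?case
    proof (cases "y = 1")
      case True
      have "(1, 1) \<in> loc (1, 1) k" using Suc.IH[of 1] m2 by simp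
      then show ?thesis using True nbr_self origin_in by auto
    next
      case False
      then obtain y' where y': "y = Suc y'" "1 \<le> y'" using Suc.prems by (cases y) auto
      have "(1, y') \<in> loc (1, 1) k" using Suc y' by auto
      moreover have "(1, y) \<in> nbr (1, y')"
        using lat_dist_vertical[of 1 m y'] y' Suc.prems p1 m2 by (auto simp: nbr_def kl_nodes_def)
      ultimately show ?thesis by auto
    qed
  qed auto
  have "min (Suc k) m = card (Pair (1::nat) ` {1..min (Suc k) m})"
    by (subst card_image) (auto intro: inj_onI)
  also have "\<dots> \<le> loc_card k"
    unfolding loc_card_def using col by (intro card_mono) auto
  finally show ?thesis .
qed

section \<open>Collision-free ball sizes and their growth\<close>

definition loc_shell :: "nat \<Rightarrow> nat" where "loc_shell k = (if k = 0 then 1 else loc_card k - loc_card (k - 1))"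

text \<open>A ball is partitioned into spheres, and \<open>loc_shell k\<close> is the size of the
  sphere of radius \<open>k\<close>. The centre needs its own case, since truncated
  \<open>k - 1\<close> would give 0 at \<open>k = 0\<close>.\<close>

lemma sum_loc_shell: "(\<Sum>i\<le>k. loc_shell i) = loc_card k"
proof (induction k)
  case (Suc k)
  then show ?case using loc_card_mono[of k "Suc k"] by (simp add: loc_shell_def)
qed (simp add: loc_shell_def)

lemma loc_shell_le: "loc_shell k \<le> loc_card k"
  by (simp add: loc_shell_def)

lemma loc_shell_1_pos: "1 \<le> loc_shell 1"
  using loc_card_ge[of 1] m2 by (simp add: loc_shell_def)

text \<open>The size of the ball of radius \<open>t\<close> in the absence of collisions.\<close>
function tree_card :: "nat \<Rightarrow> nat" where
  "tree_card t = loc_card t + q * (\<Sum>k\<in>{..<t}. loc_shell k * tree_card (t - 1 - k))"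
  by auto
termination by (relation "Wellfounded.measure id") auto

declare tree_card.simps [simp del]

lemma tree_card_0 [simp]: "tree_card 0 = 1" by (subst tree_card.simps) simp

lemma loc_card_le_tree_card: "loc_card t \<le> tree_card t" by (subst tree_card.simps) simp

lemma tree_card_pos: "0 < tree_card t"
  using loc_card_le_tree_card[of t] loc_card_mono[of 0 t] by simp

lemma tree_card_Suc: "tree_card (Suc t) = loc_card (Suc t) + q * (\<Sum>k\<le>t. loc_shell k * tree_card (t - k))"
  by (subst tree_card.simps) (simp add: lessThan_Suc_atMost)

text \<open>Bounds the size of one exploration step from a node: \<open>q\<close> contacts plus the
  closed local neighbourhood. It does not depend on \<open>m\<close>, which keeps the growth rates
  uniform.\<close>

definition deg_bound :: nat where "deg_bound = q + (2 * p + 2)\<^sup>2"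

lemma deg_bound_pos: "deg_bound > 0" by (simp add: deg_bound_def)

lemma tree_card_Suc_le: "tree_card (Suc t) \<le> deg_bound * tree_card t"
proof (induction t rule: less_induct)
  case (less t)
  \<comment> \<open>The term \<open>k = t\<close> is split off because
    \<open>tree_card 0 = 1\<close> has no predecessor for the induction hypothesis; it is charged to
    \<open>q * loc_card t\<close>.\<close>
  have "tree_card (Suc t) = loc_card (Suc t) + q * (\<Sum>k<t. loc_shell k * tree_card (t - k)) + q * loc_shell t"
    by (simp add: tree_card_Suc lessThan_Suc_atMost[symmetric] distrib_left)
  also have "q * (\<Sum>k<t. loc_shell k * tree_card (t - k)) \<le> q * (\<Sum>k<t. loc_shell k * (deg_bound * tree_card (t - 1 - k)))"
  proof (intro mult_left_mono sum_mono)
    fix k assume k: "k \<in> {..<t}"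
    then have "tree_card (Suc (t - 1 - k)) \<le> deg_bound * tree_card (t - 1 - k)" by (intro less) auto
    moreover have "Suc (t - 1 - k) = t - k" using k by auto
    ultimately show "tree_card (t - k) \<le> deg_bound * tree_card (t - 1 - k)" by simp
  qed auto
  also have "\<dots> = deg_bound * (q * (\<Sum>k<t. loc_shell k * tree_card (t - 1 - k)))"
    by (simp add: sum_distrib_left mult.left_commute mult.assoc)
  also have "loc_card (Suc t) \<le> (2 * p + 2)\<^sup>2 * loc_card t"
    using loc_card_Suc_le[of t] loc_card_1_le by (meson le_trans mult_le_mono1)
  also have "(2 * p + 2)\<^sup>2 * loc_card t + deg_bound * (q * (\<Sum>k<t. loc_shell k * tree_card (t - 1 - k))) + q * loc_shell t \<le>
     (2 * p + 2)\<^sup>2 * loc_card t + deg_bound * (q * (\<Sum>k<t. loc_shell k * tree_card (t - 1 - k))) + q * loc_card t"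
    using loc_shell_le by simp
  also have "\<dots> = deg_bound * tree_card t"
    by (subst (2) tree_card.simps) (simp add: deg_bound_def algebra_simps)
  finally show ?case by simp
qed

text \<open>The terms \<open>k = 0\<close> and \<open>k = 1\<close> of the recursion give a
  Fibonacci-type bound: \<open>tree_card (t + 1)\<close> is at least
  \<open>tree_card t + tree_card (t - 1)\<close>. By \<open>tree_card_Suc_le\<close> the last
  summand is at least \<open>tree_card t / deg_bound\<close>.\<close>

lemma tree_card_growth: "(deg_bound + 1) * tree_card t \<le> deg_bound * tree_card (Suc t)"
proof (cases t)
  case 0
  have "2 \<le> loc_card 1" using loc_card_ge[of 1] m2 by simp
  then have "2 \<le> tree_card 1" using loc_card_le_tree_card[of 1] by simp
  then have "deg_bound * 2 \<le> deg_bound * tree_card 1" by (rule mult_left_mono) simp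
  then have "deg_bound + 1 \<le> deg_bound * tree_card 1" using deg_bound_pos by linarith
  then show ?thesis by (simp add: 0)
next
  case (Suc t')
  have "(\<Sum>k\<in>{0,1}. loc_shell k * tree_card (t - k)) \<le> (\<Sum>k\<le>t. loc_shell k * tree_card (t - k))"
    using Suc by (intro sum_mono2) auto
  also have "\<dots> \<le> tree_card (Suc t)" unfolding tree_card_Suc using q1 by (simp add: trans_le_add2)
  finally have "tree_card t + loc_shell 1 * tree_card t' \<le> tree_card (Suc t)" using Suc by (simp add: loc_shell_def)
  moreover have "tree_card t' \<le> loc_shell 1 * tree_card t'" using loc_shell_1_pos by simp
  ultimately have "tree_card t + tree_card t' \<le> tree_card (Suc t)" by linarith
  then have "deg_bound * (tree_card t + tree_card t') \<le> deg_bound * tree_card (Suc t)" by (rule mult_left_mono) simp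
  moreover have "tree_card t \<le> deg_bound * tree_card t'" using tree_card_Suc_le[of t'] Suc by simp
  ultimately show ?thesis by (simp add: algebra_simps)
qed

section \<open>Exploration of a sampled network\<close>

primrec reach :: "(node \<times> nat \<Rightarrow> node) \<Rightarrow> node \<Rightarrow> nat \<Rightarrow> node set" where
  "reach L u 0 = {u}"
| "reach L u (Suc t) = (\<Union>x\<in>reach L u t. nbr x \<union> (\<lambda>i. L (x, i)) ` {..<q})"

definition valid :: "(node \<times> nat \<Rightarrow> node) \<Rightarrow> bool" where
  "valid L \<longleftrightarrow> (\<forall>x\<in>kl_nodes m. \<forall>i<q. L (x, i) \<in> kl_nodes m)"

text \<open>The nodes whose contacts have been inspected when the ball of radius \<open>t\<close> is
  known. As a union it is empty at \<open>t = 0\<close>, where a ball of radius \<open>t - 1\<close>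
  would truncate.\<close>

definition reach_lt :: "(node \<times> nat \<Rightarrow> node) \<Rightarrow> node \<Rightarrow> nat \<Rightarrow> node set" where
  "reach_lt L u t = (\<Union>j<t. reach L u j)"

definition depth :: "(node \<times> nat \<Rightarrow> node) \<Rightarrow> node \<Rightarrow> node \<Rightarrow> nat" where
  "depth L u x = (LEAST j. x \<in> reach L u j)"

lemma valid_upd: "valid L \<Longrightarrow> y \<in> kl_nodes m \<Longrightarrow> valid (L(e := y))"
  by (auto simp: valid_def)

lemma finite_reach [simp]: "finite (reach L u t)"
  by (induction t) (auto intro: finite_subset[OF nbr_subset])

lemma finite_reach_lt [simp]: "finite (reach_lt L u t)"
  by (simp add: reach_lt_def)

context
  fixes u assumes u: "u \<in> kl_nodes m"
begin

lemma reach_subset: "valid L \<Longrightarrow> reach L u t \<subseteq> kl_nodes m"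
proof (induction t)
  case (Suc t)
  then show ?case using nbr_subset by (fastforce simp: valid_def)
qed (simp add: u)

lemma reach_mono:
  assumes "valid L" "k \<le> l"
  shows "reach L u k \<subseteq> reach L u l"
  using assms(2)
proof (induction l rule: dec_induct)
  case (step l)
  have "reach L u l \<subseteq> reach L u (Suc l)"
  proof
    fix z assume z: "z \<in> reach L u l"
    then have "z \<in> nbr z" using reach_subset[OF assms(1), of l] by (intro nbr_self) blast
    then show "z \<in> reach L u (Suc l)" using z unfolding reach.simps by blast
  qed
  then show ?case using step by blast
qed simp

lemma reach_lt_Suc: "valid L \<Longrightarrow> reach_lt L u (Suc t) = reach L u t"
  using reach_mono[of L _ t] by (fastforce simp: reach_lt_def less_Suc_eq_le)

lemma reach_lt_subset: "valid L \<Longrightarrow> reach_lt L u t \<subseteq> kl_nodes m"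
  using reach_subset by (auto simp: reach_lt_def)

lemma depth_le_iff:
  assumes "valid L" "x \<in> reach L u t"
  shows "depth L u x \<le> j \<longleftrightarrow> x \<in> reach L u j"
proof
  assume "depth L u x \<le> j"
  then have "reach L u (depth L u x) \<subseteq> reach L u j" by (rule reach_mono[OF assms(1)])
  moreover have "x \<in> reach L u (depth L u x)" unfolding depth_def using assms(2) by (rule LeastI)
  ultimately show "x \<in> reach L u j" by blast
qed (simp add: depth_def Least_le)

lemma loc_subset_reach:
  assumes "valid L" "x \<in> reach L u j"
  shows "loc x k \<subseteq> reach L u (j + k)"
  by (induction k) (use assms in auto)

text \<open>The contact is reached one step after \<open>x\<close>, which leaves radius
  \<open>t - 1 - depth L u x\<close>. Membership in \<open>reach_lt\<close> makes this subtraction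
  exact.\<close>

lemma contact_loc_subset_reach:
  assumes "valid L" "x \<in> reach_lt L u t" "i < q"
  shows "loc (L (x, i)) (t - 1 - depth L u x) \<subseteq> reach L u t"
proof -
  obtain j where j: "j < t" "x \<in> reach L u j" using assms(2) by (auto simp: reach_lt_def)
  have d: "depth L u x \<le> j" "x \<in> reach L u (depth L u x)"
    using depth_le_iff[OF assms(1) j(2)] j by blast+
  have "L (x, i) \<in> reach L u (Suc (depth L u x))" using d assms(3) by auto
  from loc_subset_reach[OF assms(1) this, of "t - 1 - depth L u x"]
  have "loc (L (x, i)) (t - 1 - depth L u x) \<subseteq> reach L u (Suc (depth L u x) + (t - 1 - depth L u x))" .
  moreover have "Suc (depth L u x) + (t - 1 - depth L u x) = t" using d j by simp
  ultimately show ?thesis by (simp only:)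
qed

text \<open>A path is cut at its last long-range edge: what follows is local, and without such an
  edge the whole path is local.\<close>

lemma reach_cover:
  assumes L: "valid L"
  shows "reach L u t \<subseteq> loc u t \<union> (\<Union>x\<in>reach_lt L u t. \<Union>i<q. loc (L (x, i)) (t - 1 - depth L u x))"
proof (induction t)
  case (Suc t)
  show ?case
  proof
    fix v assume "v \<in> reach L u (Suc t)"
    then obtain x where x: "x \<in> reach L u t" "v \<in> nbr x \<or> (\<exists>i<q. v = L (x, i))" by auto
    have dx: "depth L u x \<le> t" using depth_le_iff[OF L x(1)] x(1) by blast
    from x(2) show "v \<in> loc u (Suc t) \<union>
        (\<Union>x\<in>reach_lt L u (Suc t). \<Union>i<q. loc (L (x, i)) (Suc t - 1 - depth L u x))"
    proof
      assume v: "v \<in> nbr x"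
      from x(1) Suc.IH consider "x \<in> loc u t"
        | y i where "y \<in> reach_lt L u t" "i < q" "x \<in> loc (L (y, i)) (t - 1 - depth L u y)" by blast
      then show ?thesis
      proof cases
        case 2
        obtain j where j: "j < t" "y \<in> reach L u j" using 2 by (auto simp: reach_lt_def)
        have "depth L u y < t" using depth_le_iff[OF L j(2), of j] j by auto
        then have "Suc t - 1 - depth L u y = Suc (t - 1 - depth L u y)" by simp
        then have "v \<in> loc (L (y, i)) (Suc t - 1 - depth L u y)" using 2 v by auto
        moreover have "y \<in> reach_lt L u (Suc t)" using 2 by (auto simp: reach_lt_def intro: less_SucI)
        ultimately show ?thesis using 2 by blast
      qed (use v in auto)
    next
      assume "\<exists>i<q. v = L (x, i)"
      then obtain i where i: "i < q" "v = L (x, i)" by blast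
      have "v \<in> kl_nodes m" using i x reach_subset[OF L] L by (auto simp: valid_def)
      then have "v \<in> loc (L (x, i)) (Suc t - 1 - depth L u x)"
        using loc_mono[of v 0 "t - depth L u x"] i by auto
      then show ?thesis using i x reach_lt_Suc[OF L] by blast
    qed
  qed
qed simp

text \<open>Double counting. Each local ball splits into spheres, and the sphere of radius
  \<open>k\<close> occurs exactly for the nodes of depth at most \<open>t - 1 - k\<close>. This
  produces the sum in the recursion of \<open>tree_card\<close>.\<close>

lemma sum_loc_card_depth:
  assumes L: "valid L"
  shows "(\<Sum>x\<in>reach_lt L u t. loc_card (t - 1 - depth L u x)) = (\<Sum>k<t. loc_shell k * card (reach L u (t - 1 - k)))"
proof (cases t)
  case (Suc t')
  have "(\<Sum>x\<in>reach_lt L u t. loc_card (t - 1 - depth L u x)) = (\<Sum>x\<in>reach L u t'. loc_card (t' - depth L u x))"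
    using Suc reach_lt_Suc[OF L] by simp
  also have "\<dots> = (\<Sum>x\<in>reach L u t'. \<Sum>k\<le>t'. if x \<in> reach L u (t' - k) then loc_shell k else 0)"
  proof (rule sum.cong)
    fix x assume x: "x \<in> reach L u t'"
    have "depth L u x \<le> t'" using depth_le_iff[OF L x] x by blast
    then have "{k. k \<le> t' \<and> x \<in> reach L u (t' - k)} = {..t' - depth L u x}"
      unfolding depth_le_iff[OF L x, symmetric] by auto
    then have "(\<Sum>k\<le>t'. if x \<in> reach L u (t' - k) then loc_shell k else 0) = (\<Sum>k\<le>t' - depth L u x. loc_shell k)"
      by (simp add: sum.If_cases Int_def)
    then show "loc_card (t' - depth L u x) = (\<Sum>k\<le>t'. if x \<in> reach L u (t' - k) then loc_shell k else 0)"
      by (simp add: sum_loc_shell)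
  qed simp
  also have "\<dots> = (\<Sum>k\<le>t'. \<Sum>x\<in>reach L u t'. if x \<in> reach L u (t' - k) then loc_shell k else 0)"
    by (rule sum.swap)
  also have "\<dots> = (\<Sum>k\<le>t'. loc_shell k * card (reach L u (t' - k)))"
  proof (rule sum.cong)
    fix k
    have "reach L u t' \<inter> reach L u (t' - k) = reach L u (t' - k)"
      using reach_mono[OF L, of "t' - k" t'] by auto
    then show "(\<Sum>x\<in>reach L u t'. if x \<in> reach L u (t' - k) then loc_shell k else 0) = loc_shell k * card (reach L u (t' - k))"
      by (simp add: sum.If_cases)
  qed simp
  finally show ?thesis using Suc by (simp add: lessThan_Suc_atMost)
qed (simp add: reach_lt_def)

text \<open>A union bound over \<open>reach_cover\<close> satisfies the recursion of
  \<open>tree_card\<close> with inequality.\<close>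

lemma card_reach_le:
  assumes L: "valid L"
  shows "card (reach L u t) \<le> tree_card t"
proof (induction t rule: less_induct)
  case (less t)
  have "card (reach L u t) \<le> card (loc u t \<union> (\<Union>x\<in>reach_lt L u t. \<Union>i<q. loc (L (x, i)) (t - 1 - depth L u x)))"
    by (intro card_mono reach_cover L) auto
  also have "\<dots> \<le> card (loc u t) + card (\<Union>x\<in>reach_lt L u t. \<Union>i<q. loc (L (x, i)) (t - 1 - depth L u x))"
    by (rule card_Un_le)
  also have "card (\<Union>x\<in>reach_lt L u t. \<Union>i<q. loc (L (x, i)) (t - 1 - depth L u x))
      \<le> (\<Sum>x\<in>reach_lt L u t. card (\<Union>i<q. loc (L (x, i)) (t - 1 - depth L u x)))"
    by (rule card_UN_le) simp
  also have "\<dots> \<le> (\<Sum>x\<in>reach_lt L u t. \<Sum>i<q. card (loc (L (x, i)) (t - 1 - depth L u x)))"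
    by (intro sum_mono card_UN_le) simp
  also have "\<dots> = (\<Sum>x\<in>reach_lt L u t. \<Sum>i<q. loc_card (t - 1 - depth L u x))"
    using reach_lt_subset[OF L] L by (intro sum.cong card_loc refl) (auto simp: valid_def)
  also have "\<dots> = q * (\<Sum>x\<in>reach_lt L u t. loc_card (t - 1 - depth L u x))"
    by (simp add: sum_distrib_left)
  also have "\<dots> = q * (\<Sum>k<t. loc_shell k * card (reach L u (t - 1 - k)))"
    by (simp only: sum_loc_card_depth[OF L])
  also have "\<dots> \<le> q * (\<Sum>k<t. loc_shell k * tree_card (t - 1 - k))"
    by (intro mult_left_mono sum_mono less) auto
  also have "card (loc u t) + \<dots> = tree_card t"
    by (subst tree_card.simps) (simp add: card_loc[OF u])
  finally show ?case by simp
qed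

text \<open>Locality of the exploration, the source of all independence used below: the ball of
  radius \<open>t\<close> is determined by the contacts of the nodes in
  \<open>reach_lt\<close>.\<close>

lemma reach_cong:
  assumes "valid L" "\<And>x i. x \<in> reach_lt L u t \<Longrightarrow> i < q \<Longrightarrow> L' (x, i) = L (x, i)"
  shows "reach L' u t = reach L u t"
  using assms(2)
proof (induction t)
  case (Suc t)
  have "reach_lt L u t \<subseteq> reach_lt L u (Suc t)"
    unfolding reach_lt_def by (intro UN_mono) auto
  then have IH: "reach L' u t = reach L u t"
    using Suc.prems by (intro Suc.IH) blast
  have "(\<lambda>i. L' (x, i)) ` {..<q} = (\<lambda>i. L (x, i)) ` {..<q}" if "x \<in> reach L u t" for x
    using Suc.prems that reach_lt_Suc[OF assms(1)] by (intro image_cong) auto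
  then show ?case unfolding reach.simps IH by (intro SUP_cong) auto
qed simp

text \<open>An edge out of \<open>x\<close> is inspected only after \<open>x\<close> has been
  reached, so balls up to the depth of \<open>x\<close> cannot depend on it.\<close>

lemma reach_upd_le_depth:
  assumes L: "valid L" and x: "x \<in> reach L u k" and j: "j \<le> depth L u x"
  shows "reach (L((x, i) := y)) u j = reach L u j"
proof (rule reach_cong[OF L])
  fix z i' assume "z \<in> reach_lt L u j" "i' < q"
  then obtain j' where "j' < j" "z \<in> reach L u j'" by (auto simp: reach_lt_def)
  then have "z \<noteq> x" using depth_le_iff[OF L x, of j'] j by auto
  then show "(L((x, i) := y)) (z, i') = L (z, i')" by simp
qed

text \<open>A node reached along two different long-range edges is charged to the later one: the
  self-loop \<open>L (x, i) := x\<close> switches the edge \<open>(x, i)\<close> off, and the earlier edge still leads to the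
  node.\<close>
lemma card_reach_ge:
  assumes L: "valid L"
  shows "loc_card t + (\<Sum>x\<in>reach_lt L u t. \<Sum>i<q. card (loc (L (x, i)) (t - 1 - depth L u x)
      - reach (L((x, i) := x)) u t)) \<le> card (reach L u t)"
proof -
  define W where "W e = loc (L e) (t - 1 - depth L u (fst e)) - reach (L(e := fst e)) u t" for e :: "node \<times> nat"
  define I where "I = reach_lt L u t \<times> {..<q}"
  have V: "fst e \<in> kl_nodes m" if "e \<in> I" for e
    using that reach_lt_subset[OF L, of t] by (simp add: I_def mem_Times_iff) blast
  \<comment> \<open>With the later edge \<open>e'\<close> switched off, \<open>x\<close> is still
    reached at its old depth and \<open>e\<close> still leads to its contact. The local ball behind
    \<open>e\<close> therefore stays in the smaller ball that \<open>W e'\<close> excludes.\<close>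
  have disj: "W e \<inter> W e' = {}"
    if e: "e \<in> I" "e' \<in> I" "e \<noteq> e'" "depth L u (fst e) \<le> depth L u (fst e')" for e e'
  proof -
    obtain x i x' i' where ee: "e = (x, i)" "e' = (x', i')" by (metis surj_pair)
    obtain j where j: "j < t" "x \<in> reach L u j" using e by (auto simp: ee I_def reach_lt_def)
    obtain j' where j': "x' \<in> reach L u j'" using e by (auto simp: ee I_def reach_lt_def)
    define L' where "L' = L(e' := x')"
    have L': "valid L'" unfolding L'_def using V[OF e(2)] L by (auto simp: ee intro: valid_upd)
    have "reach L' u (depth L u x) = reach L u (depth L u x)"
      unfolding L'_def ee by (rule reach_upd_le_depth[OF L j']) (use e in \<open>simp add: ee\<close>)
    then have "x \<in> reach L' u (depth L u x)" using depth_le_iff[OF L j(2)] by blast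
    moreover have "L' (x, i) = L (x, i)" using e by (auto simp: L'_def ee)
    ultimately have "L (x, i) \<in> reach L' u (Suc (depth L u x))"
      using e by (auto simp: ee I_def intro!: bexI[of _ x] image_eqI[of _ _ i])
    from loc_subset_reach[OF L' this, of "t - 1 - depth L u x"]
    have "loc (L e) (t - 1 - depth L u x) \<subseteq> reach L' u (Suc (depth L u x) + (t - 1 - depth L u x))"
      by (simp only: ee)
    moreover have "Suc (depth L u x) + (t - 1 - depth L u x) = t"
      using depth_le_iff[OF L j(2), of j] j by simp
    ultimately have "loc (L e) (t - 1 - depth L u x) \<subseteq> reach L' u t" by (simp only:)
    then show ?thesis by (auto simp: W_def L'_def ee)
  qed
  have disj': "W e \<inter> W e' = {}" if "e \<in> I" "e' \<in> I" "e \<noteq> e'" for e e'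
    using disj[OF that] disj[OF that(2,1)] that(3) by (metis Int_commute nat_le_linear)
  \<comment> \<open>The local ball around \<open>u\<close> is reached without any long-range
    edge.\<close>
  have root: "loc u t \<inter> W e = {}" if "e \<in> I" for e
    using loc_subset_reach[OF valid_upd[OF L V[OF that], of e], of u 0 t] by (auto simp: W_def)
  have "loc_card t + (\<Sum>x\<in>reach_lt L u t. \<Sum>i<q. card (loc (L (x, i)) (t - 1 - depth L u x)
      - reach (L((x, i) := x)) u t)) = loc_card t + (\<Sum>e\<in>I. card (W e))"
    unfolding I_def W_def by (simp add: sum.cartesian_product case_prod_unfold)
  also have "(\<Sum>e\<in>I. card (W e)) = card (\<Union>e\<in>I. W e)"
  proof (rule card_UN_disjoint[symmetric])
    show "\<forall>e\<in>I. \<forall>e'\<in>I. e \<noteq> e' \<longrightarrow> W e \<inter> W e' = {}" using disj' by blast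
  qed (auto simp: I_def W_def)
  also have "loc_card t + \<dots> = card (loc u t \<union> (\<Union>e\<in>I. W e))"
    using root by (subst card_Un_disjoint) (auto simp: I_def W_def card_loc[OF u])
  also have "\<dots> \<le> card (reach L u t)"
  proof (rule card_mono)
    show "loc u t \<union> (\<Union>e\<in>I. W e) \<subseteq> reach L u t"
      using loc_subset_reach[OF L, of u 0 t] contact_loc_subset_reach[OF L]
      by (fastforce simp: I_def W_def)
  qed simp
  finally show ?thesis .
qed

end

end

subsection \<open>Expected size of balls\<close>

text \<open>Independence of coordinate \<open>e\<close> from the others. Overwriting it by a
  constant \<open>c\<close> expresses "all other coordinates" without changing the type of the
  function.\<close>

lemma Pi_pmf_resample:
  assumes "finite A" "e \<in> A"
  shows "map_pmf (\<lambda>L. (L(e := c), L e)) (Pi_pmf A d P) =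
    do {L \<leftarrow> Pi_pmf A d P; y \<leftarrow> P e; return_pmf (L(e := c), y)}"
proof -
  have A: "A = insert e (A - {e})" "finite (A - {e})" "e \<notin> A - {e}" using assms by auto
  have Pi: "Pi_pmf A d P = do {y \<leftarrow> P e; f \<leftarrow> Pi_pmf (A - {e}) d P; return_pmf (f(e := y))}"
    using Pi_pmf_insert'[OF A(2,3), of d P] A(1) by simp
  have "map_pmf (\<lambda>L. (L(e := c), L e)) (Pi_pmf A d P)
      = do {y \<leftarrow> P e; f \<leftarrow> Pi_pmf (A - {e}) d P; return_pmf (f(e := c), y)}"
    unfolding Pi by (simp add: map_pmf_def bind_assoc_pmf bind_return_pmf)
  also have "\<dots> = do {f \<leftarrow> Pi_pmf (A - {e}) d P; y \<leftarrow> P e; return_pmf (f(e := c), y)}"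
    by (rule bind_commute_pmf)
  also have "\<dots> = do {L \<leftarrow> Pi_pmf A d P; y \<leftarrow> P e; return_pmf (L(e := c), y)}"
    unfolding Pi by (simp add: bind_assoc_pmf bind_return_pmf)
  finally show ?thesis .
qed

lemma expectation_bind_finite:
  fixes h :: "'b \<Rightarrow> real"
  assumes "finite (set_pmf M)" "\<And>x. x \<in> set_pmf M \<Longrightarrow> finite (set_pmf (N x))"
  shows "measure_pmf.expectation (bind_pmf M N) h
    = measure_pmf.expectation M (\<lambda>x. measure_pmf.expectation (N x) h)"
  using assms by (subst pmf_expectation_bind[OF assms(1)])
    (auto simp: integral_measure_pmf[OF assms(1)])

lemma expectation_Pi_pmf_resample:
  fixes F :: "('a \<Rightarrow> 'b) \<Rightarrow> 'b \<Rightarrow> real"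
  assumes "finite A" "e \<in> A" "finite (set_pmf (Pi_pmf A d P))" "finite (set_pmf (P e))"
  shows "measure_pmf.expectation (Pi_pmf A d P) (\<lambda>L. F (L(e := c)) (L e))
    = measure_pmf.expectation (Pi_pmf A d P) (\<lambda>L. measure_pmf.expectation (P e) (F (L(e := c))))"
proof -
  have "measure_pmf.expectation (Pi_pmf A d P) (\<lambda>L. F (L(e := c)) (L e))
    = measure_pmf.expectation (map_pmf (\<lambda>L. (L(e := c), L e)) (Pi_pmf A d P)) (\<lambda>z. F (fst z) (snd z))"
    by simp
  also have "\<dots> = measure_pmf.expectation (Pi_pmf A d P) (\<lambda>L. measure_pmf.expectation (P e) (F (L(e := c))))"
    unfolding Pi_pmf_resample[OF assms(1,2)] using assms(3,4)
    by (simp add: expectation_bind_finite)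
  finally show ?thesis .
qed

context kleinberg
begin

abbreviation mean :: "((node \<times> nat \<Rightarrow> node) \<Rightarrow> real) \<Rightarrow> real" where
  "mean f \<equiv> measure_pmf.expectation (kl_long m r q) f"

text \<open>\<open>\<gamma>\<close> and \<open>K\<close> are the exponent and the constant of
  \<open>contact_expectation_le\<close>. \<open>\<delta> t\<close> is its bound at density
  \<open>tree_card t / m\<^sup>2\<close>, the fraction that collisions may cost at radius
  \<open>t\<close>.\<close>

definition \<gamma> :: real where "\<gamma> = (2 - r) / (2 + r)"
definition K :: real where "K = 2 * (1 + (12 / (2 - r))\<^sup>2)"
definition \<delta> :: "nat \<Rightarrow> real" where "\<delta> t = K * (real (tree_card t) / (real m)\<^sup>2) powr \<gamma>"

lemma \<gamma>_pos: "0 < \<gamma>" using r0 r2 by (simp add: \<gamma>_def)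
lemma K_pos: "0 < K" unfolding K_def by (simp add: add_pos_nonneg)
lemma \<delta>_nonneg: "0 \<le> \<delta> t" using K_pos by (simp add: \<delta>_def)

lemma finite_contact: "x \<in> kl_nodes m \<Longrightarrow> finite (set_pmf (contact_pmf m r x))"
  using finite_subset[OF set_pmf_contact[OF _ r0 m2]] by simp

lemma set_pmf_kl_long:
  "set_pmf (kl_long m r q)
    = PiE_dflt (kl_nodes m \<times> {..<q}) (0, 0) (\<lambda>(x, i). set_pmf (contact_pmf m r x))"
  unfolding kl_long_def by (subst set_Pi_pmf) (auto simp: o_def case_prod_unfold)

lemma finite_kl_long: "finite (set_pmf (kl_long m r q))"
  unfolding set_pmf_kl_long by (intro finite_PiE_dflt) (auto intro: finite_contact)

lemma integrable_kl_long [simp]: "integrable (measure_pmf (kl_long m r q)) (f :: _ \<Rightarrow> real)"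
  by (rule integrable_measure_pmf_finite[OF finite_kl_long])

lemma valid_kl_long:
  assumes "L \<in> set_pmf (kl_long m r q)"
  shows "valid L"
  unfolding valid_def
proof (intro ballI allI impI)
  fix x i assume x: "x \<in> kl_nodes m" "i < q"
  then have "L (x, i) \<in> set_pmf (contact_pmf m r x)"
    using assms unfolding set_pmf_kl_long PiE_dflt_def by fastforce
  then show "L (x, i) \<in> kl_nodes m" using set_pmf_contact[OF x(1) r0 m2] by blast
qed

lemma mean_mono: "(\<And>L. valid L \<Longrightarrow> f L \<le> g L) \<Longrightarrow> mean f \<le> mean g"
  by (intro integral_mono_AE) (auto simp: AE_measure_pmf_iff valid_kl_long)

lemma mean_cong: "(\<And>L. valid L \<Longrightarrow> f L = g L) \<Longrightarrow> mean f = mean g"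
  by (intro integral_cong_AE) (auto simp: AE_measure_pmf_iff valid_kl_long)

lemma mean_resample:
  assumes "x \<in> kl_nodes m" "i < q"
  shows "mean (\<lambda>L. F (L((x, i) := c)) (L (x, i)))
    = mean (\<lambda>L. measure_pmf.expectation (contact_pmf m r x) (F (L((x, i) := c))))"
  unfolding kl_long_def using assms finite_contact finite_kl_long[unfolded kl_long_def]
  by (subst expectation_Pi_pmf_resample) auto

text \<open>\<open>contact_expectation_le\<close> is applied to the fraction \<open>h y\<close> of
  the local ball around \<open>y\<close> that lies in \<open>S\<close>. By symmetry of local balls
  each point of \<open>S\<close> is counted \<open>loc_card k\<close> times, so \<open>h\<close>
  sums to \<open>card S\<close>.\<close>

lemma contact_overlap_le:
  assumes x: "x \<in> kl_nodes m" and S: "S \<subseteq> kl_nodes m"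
  shows "measure_pmf.expectation (contact_pmf m r x) (\<lambda>y. real (card (loc y k \<inter> S)))
    \<le> real (loc_card k) * (K * (real (card S) / (real m)\<^sup>2) powr \<gamma>)"
proof -
  have finS: "finite S" using S finite_subset by (metis finite_kl_nodes)
  have bpos: "0 < real (loc_card k)" using loc_card_mono[of 0 k] by simp
  define h where "h y = real (card (loc y k \<inter> S)) / real (loc_card k)" for y
  have h: "0 \<le> h y" "h y \<le> 1" if "y \<in> kl_nodes m" for y
  proof -
    have "card (loc y k \<inter> S) \<le> loc_card k"
      using card_loc[OF that, of k] by (metis card_mono finite_loc inf_le1)
    then show "h y \<le> 1" using bpos by (simp add: h_def)
  qed (simp add: h_def)
  have "(\<Sum>y\<in>kl_nodes m. card (loc y k \<inter> S)) = (\<Sum>y\<in>kl_nodes m. \<Sum>z\<in>S. if z \<in> loc y k then 1 else 0)"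
    using finS by (intro sum.cong refl) (simp add: sum.If_cases Int_commute)
  also have "\<dots> = (\<Sum>z\<in>S. \<Sum>y\<in>kl_nodes m. if z \<in> loc y k then 1 else 0)" by (rule sum.swap)
  also have "\<dots> = (\<Sum>z\<in>S. loc_card k)"
  proof (rule sum.cong)
    fix z assume "z \<in> S"
    then have z: "z \<in> kl_nodes m" using S by blast
    have "kl_nodes m \<inter> {y. z \<in> loc y k} = loc z k"
      using loc_sym loc_subset[OF z, of k] z by blast
    then show "(\<Sum>y\<in>kl_nodes m. if z \<in> loc y k then 1 else 0) = loc_card k"
      by (simp add: sum.If_cases card_loc[OF z])
  qed simp
  finally have cnt: "(\<Sum>y\<in>kl_nodes m. card (loc y k \<inter> S)) = card S * loc_card k" by simp
  have "(\<Sum>y\<in>kl_nodes m. h y) = real (\<Sum>y\<in>kl_nodes m. card (loc y k \<inter> S)) / real (loc_card k)"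
    by (simp add: h_def sum_divide_distrib)
  also have "\<dots> = real (card S)" unfolding cnt using bpos by simp
  finally have sum_h: "(\<Sum>y\<in>kl_nodes m. h y) = real (card S)" .
  have "measure_pmf.expectation (contact_pmf m r x) (\<lambda>y. real (card (loc y k \<inter> S)))
    = (\<Sum>y\<in>kl_nodes m. real (card (loc y k \<inter> S)) * pmf (contact_pmf m r x) y)"
    using set_pmf_contact[OF x r0 m2] by (intro integral_measure_pmf_real) auto
  also have "\<dots> = real (loc_card k) * (\<Sum>y\<in>kl_nodes m. h y * pmf (contact_pmf m r x) y)"
    using bpos by (simp add: h_def sum_distrib_left)
  also have "\<dots> \<le> real (loc_card k) * (K * ((\<Sum>y\<in>kl_nodes m. h y) / (real m)\<^sup>2) powr \<gamma>)"
    unfolding K_def \<gamma>_def using bpos h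
    by (intro mult_left_mono contact_expectation_le x r0 r2 m2) auto
  finally show ?thesis unfolding sum_h .
qed

section \<open>Expected loss through collisions\<close>

context
  fixes u assumes u: "u \<in> kl_nodes m"
begin

lemma reach_upd_self:
  assumes L: "valid L" and x: "x \<in> kl_nodes m" and y: "y \<in> kl_nodes m" and i: "i < q"
  shows "x \<in> reach (L((x, i) := y)) u j \<longleftrightarrow> x \<in> reach L u j"
proof -
  \<comment> \<open>One direction is proved for every valid network; the converse follows by
    restoring the old endpoint with a second update.\<close>
  have *: "x \<in> reach (L((x, i) := y)) u j" if L: "valid L" and y: "y \<in> kl_nodes m" and xj: "x \<in> reach L u j"
    for L y
  proof -
    have d: "depth L u x \<le> j" "x \<in> reach L u (depth L u x)"
      using depth_le_iff[OF u L xj] xj by blast+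
    have "reach (L((x, i) := y)) u (depth L u x) = reach L u (depth L u x)"
      by (rule reach_upd_le_depth[OF u L xj]) simp
    then show ?thesis using d reach_mono[OF u valid_upd[OF L y] d(1)] by blast
  qed
  show ?thesis
  proof
    assume "x \<in> reach (L((x, i) := y)) u j"
    moreover have "L (x, i) \<in> kl_nodes m" using L x i by (auto simp: valid_def)
    ultimately have "x \<in> reach ((L((x, i) := y))((x, i) := L (x, i))) u j"
      by (intro *[OF valid_upd[OF L y]])
    then show "x \<in> reach L u j" by simp
  qed (rule *[OF L y])
qed

lemma reach_lt_upd_self:
  assumes "valid L" "x \<in> kl_nodes m" "y \<in> kl_nodes m" "i < q"
  shows "x \<in> reach_lt (L((x, i) := y)) u t \<longleftrightarrow> x \<in> reach_lt L u t"
  using reach_upd_self[OF assms] by (simp add: reach_lt_def)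

lemma depth_upd_self:
  assumes "valid L" "x \<in> kl_nodes m" "y \<in> kl_nodes m" "i < q"
  shows "depth (L((x, i) := y)) u x = depth L u x"
  using reach_upd_self[OF assms] by (simp add: depth_def)

text \<open>\<open>L\<close> stands for the network with one edge out of \<open>x\<close> switched
  off and \<open>y\<close> for the endpoint of that edge. Keeping them apart allows \<open>y\<close>
  to be averaged independently of \<open>L\<close>.\<close>

definition loss :: "nat \<Rightarrow> node \<Rightarrow> (node \<times> nat \<Rightarrow> node) \<Rightarrow> node \<Rightarrow> real" where
  "loss t x L y = (if x \<in> reach_lt L u t
     then real (card (loc y (t - 1 - depth L u x) \<inter> reach L u t)) else 0)"

definition gain :: "nat \<Rightarrow> node \<Rightarrow> (node \<times> nat \<Rightarrow> node) \<Rightarrow> real" where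
  "gain t x L = (if x \<in> reach_lt L u t then real (loc_card (t - 1 - depth L u x)) else 0)"

lemma sum_gain:
  assumes L: "valid L"
  shows "(\<Sum>x\<in>kl_nodes m. \<Sum>i<q. gain t x L)
    = real q * (\<Sum>k<t. real (loc_shell k) * real (card (reach L u (t - 1 - k))))"
proof -
  have "(\<Sum>x\<in>kl_nodes m. gain t x L) = (\<Sum>x\<in>reach_lt L u t. real (loc_card (t - 1 - depth L u x)))"
    unfolding gain_def using reach_lt_subset[OF u L, of t]
    by (simp add: sum.If_cases Int_absorb1)
  also have "\<dots> = real (\<Sum>x\<in>reach_lt L u t. loc_card (t - 1 - depth L u x))" by simp
  also have "\<dots> = (\<Sum>k<t. real (loc_shell k) * real (card (reach L u (t - 1 - k))))"
    unfolding sum_loc_card_depth[OF u L] by simp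
  finally show ?thesis by (simp add: sum_distrib_left[symmetric])
qed

text \<open>\<open>card_reach_ge\<close> with sums over all nodes instead of a random index set, so
  that expectations can be taken term by term. Whether \<open>x\<close> is inspected, and its depth,
  do not change when its own edge is switched off.\<close>

lemma card_reach_ge_gain:
  assumes L: "valid L"
  shows "real (loc_card t) + (\<Sum>x\<in>kl_nodes m. \<Sum>i<q. gain t x L)
      - (\<Sum>x\<in>kl_nodes m. \<Sum>i<q. loss t x (L((x, i) := x)) (L (x, i))) \<le> real (card (reach L u t))"
proof -
  have "(\<Sum>x\<in>kl_nodes m. \<Sum>i<q. gain t x L) - (\<Sum>x\<in>kl_nodes m. \<Sum>i<q. loss t x (L((x, i) := x)) (L (x, i)))
    = (\<Sum>x\<in>kl_nodes m. \<Sum>i<q. gain t x L - loss t x (L((x, i) := x)) (L (x, i)))"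
    by (simp add: sum_subtractf)
  also have "\<dots> = (\<Sum>x\<in>kl_nodes m. if x \<in> reach_lt L u t then
     (\<Sum>i<q. real (card (loc (L (x, i)) (t - 1 - depth L u x) - reach (L((x, i) := x)) u t))) else 0)"
  proof (rule sum.cong)
    fix x assume x: "x \<in> kl_nodes m"
    have "gain t x L - loss t x (L((x, i) := x)) (L (x, i)) = (if x \<in> reach_lt L u t then
       real (card (loc (L (x, i)) (t - 1 - depth L u x) - reach (L((x, i) := x)) u t)) else 0)"
      if i: "i < q" for i
    proof -
      have "L (x, i) \<in> kl_nodes m" using L x i by (auto simp: valid_def)
      then have "real (card (loc (L (x, i)) k - S)) = real (loc_card k) - real (card (loc (L (x, i)) k \<inter> S))" for k S
        using card_Int_Diff[OF finite_loc, of "L (x, i)" k S] card_loc[of "L (x, i)" k] by simp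
      then show ?thesis
        by (simp add: gain_def loss_def reach_lt_upd_self[OF L x x i] depth_upd_self[OF L x x i])
    qed
    then show "(\<Sum>i<q. gain t x L - loss t x (L((x, i) := x)) (L (x, i))) = (if x \<in> reach_lt L u t then
     (\<Sum>i<q. real (card (loc (L (x, i)) (t - 1 - depth L u x) - reach (L((x, i) := x)) u t))) else 0)"
      by simp
  qed simp
  also have "\<dots> = real (\<Sum>x\<in>reach_lt L u t. \<Sum>i<q. card (loc (L (x, i)) (t - 1 - depth L u x)
      - reach (L((x, i) := x)) u t))"
    using reach_lt_subset[OF u L, of t] by (simp add: sum.If_cases Int_absorb1)
  finally show ?thesis using card_reach_ge[OF u L, of t] by linarith
qed

lemma expected_loss_le:
  assumes L: "valid L" and x: "x \<in> kl_nodes m"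
  shows "measure_pmf.expectation (contact_pmf m r x) (loss t x L) \<le> \<delta> t * gain t x L"
proof (cases "x \<in> reach_lt L u t")
  case True
  define k where "k = t - 1 - depth L u x"
  have "measure_pmf.expectation (contact_pmf m r x) (loss t x L)
     = measure_pmf.expectation (contact_pmf m r x) (\<lambda>y. real (card (loc y k \<inter> reach L u t)))"
    by (rule arg_cong[where f = "measure_pmf.expectation _"]) (simp add: fun_eq_iff loss_def k_def True)
  also have "\<dots> \<le> real (loc_card k) * (K * (real (card (reach L u t)) / (real m)\<^sup>2) powr \<gamma>)"
    by (rule contact_overlap_le[OF x reach_subset[OF u L]])
  also have "\<dots> \<le> real (loc_card k) * (K * (real (tree_card t) / (real m)\<^sup>2) powr \<gamma>)"
    using K_pos \<gamma>_pos card_reach_le[OF u L, of t]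
    by (intro mult_left_mono powr_mono2 divide_right_mono) auto
  finally show ?thesis by (simp add: gain_def k_def True \<delta>_def mult.commute)
next
  case False
  then have "loss t x L = (\<lambda>_. 0)" by (simp add: fun_eq_iff loss_def)
  then show ?thesis using False by (simp add: gain_def)
qed

definition mean_reach :: "nat \<Rightarrow> real" where
  "mean_reach t = mean (\<lambda>L. real (card (reach L u t)))"

lemma mean_reach_le: "mean_reach t \<le> real (tree_card t)"
proof -
  have "mean_reach t \<le> mean (\<lambda>L. real (tree_card t))"
    unfolding mean_reach_def using card_reach_le[OF u] by (intro mean_mono) simp
  then show ?thesis by simp
qed

text \<open>Each edge is resampled independently of the rest, so its expected loss is at most
  \<open>\<delta> t\<close> times its expected gain. The total expected gain is at most
  \<open>tree_card t\<close>.\<close>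

lemma mean_reach_recurrence:
  "real (loc_card t) + real q * (\<Sum>k<t. real (loc_shell k) * mean_reach (t - 1 - k))
     - \<delta> t * real (tree_card t) \<le> mean_reach t"
proof -
  define G where "G = real q * (\<Sum>k<t. real (loc_shell k) * mean_reach (t - 1 - k))"
  have G: "mean (\<lambda>L. \<Sum>x\<in>kl_nodes m. \<Sum>i<q. gain t x L) = G"
  proof -
    have "mean (\<lambda>L. \<Sum>x\<in>kl_nodes m. \<Sum>i<q. gain t x L)
      = mean (\<lambda>L. real q * (\<Sum>k<t. real (loc_shell k) * real (card (reach L u (t - 1 - k)))))"
      by (intro mean_cong sum_gain)
    also have "\<dots> = G" by (simp add: G_def mean_reach_def)
    finally show ?thesis .
  qed
  have "G \<le> real q * (\<Sum>k<t. real (loc_shell k) * real (tree_card (t - 1 - k)))"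
    unfolding G_def by (intro mult_left_mono sum_mono mean_reach_le) auto
  also have "\<dots> \<le> real (tree_card t)"
    by (subst (2) tree_card.simps) simp
  finally have G_le: "G \<le> real (tree_card t)" .
  have "mean (\<lambda>L. \<Sum>x\<in>kl_nodes m. \<Sum>i<q. loss t x (L((x, i) := x)) (L (x, i)))
     = (\<Sum>x\<in>kl_nodes m. \<Sum>i<q. mean (\<lambda>L. loss t x (L((x, i) := x)) (L (x, i))))" by simp
  also have "\<dots> \<le> (\<Sum>x\<in>kl_nodes m. \<Sum>i<q. mean (\<lambda>L. \<delta> t * gain t x L))"
  proof (intro sum_mono)
    fix x i assume x: "x \<in> kl_nodes m" and "i \<in> {..<q}"
    then have i: "i < q" by simp
    have "mean (\<lambda>L. loss t x (L((x, i) := x)) (L (x, i)))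
       = mean (\<lambda>L. measure_pmf.expectation (contact_pmf m r x) (loss t x (L((x, i) := x))))"
      by (rule mean_resample[OF x i])
    also have "\<dots> \<le> mean (\<lambda>L. \<delta> t * gain t x L)"
    proof (rule mean_mono)
      fix L assume L: "valid L"
      have "gain t x (L((x, i) := x)) = gain t x L"
        by (simp add: gain_def reach_lt_upd_self[OF L x x i] depth_upd_self[OF L x x i])
      then show "measure_pmf.expectation (contact_pmf m r x) (loss t x (L((x, i) := x))) \<le> \<delta> t * gain t x L"
        using expected_loss_le[OF valid_upd[OF L x, of "(x, i)"] x, of t] by simp
    qed
    finally show "mean (\<lambda>L. loss t x (L((x, i) := x)) (L (x, i))) \<le> mean (\<lambda>L. \<delta> t * gain t x L)" .
  qed
  also have "\<dots> = \<delta> t * mean (\<lambda>L. \<Sum>x\<in>kl_nodes m. \<Sum>i<q. gain t x L)"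
    by (simp add: sum_distrib_left mult.left_commute)
  also have "\<dots> \<le> \<delta> t * real (tree_card t)"
    unfolding G using G_le \<delta>_nonneg by (intro mult_left_mono)
  finally have loss: "mean (\<lambda>L. \<Sum>x\<in>kl_nodes m. \<Sum>i<q. loss t x (L((x, i) := x)) (L (x, i)))
     \<le> \<delta> t * real (tree_card t)" .
  have "mean (\<lambda>L. real (loc_card t) + (\<Sum>x\<in>kl_nodes m. \<Sum>i<q. gain t x L)
      - (\<Sum>x\<in>kl_nodes m. \<Sum>i<q. loss t x (L((x, i) := x)) (L (x, i)))) \<le> mean_reach t"
    unfolding mean_reach_def by (intro mean_mono card_reach_ge_gain)
  also have "mean (\<lambda>L. real (loc_card t) + (\<Sum>x\<in>kl_nodes m. \<Sum>i<q. gain t x L)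
      - (\<Sum>x\<in>kl_nodes m. \<Sum>i<q. loss t x (L((x, i) := x)) (L (x, i))))
    = real (loc_card t) + mean (\<lambda>L. \<Sum>x\<in>kl_nodes m. \<Sum>i<q. gain t x L)
      - mean (\<lambda>L. \<Sum>x\<in>kl_nodes m. \<Sum>i<q. loss t x (L((x, i) := x)) (L (x, i)))"
    by (subst Bochner_Integration.integral_diff, simp, simp, subst Bochner_Integration.integral_add) simp_all
  finally show ?thesis using loss unfolding G G_def by linarith
qed

text \<open>Relative errors add up along the recursion: smaller radii contribute at most the sum of
  \<open>\<delta> j\<close> over \<open>j < t\<close>, and radius \<open>t\<close> adds
  \<open>\<delta> t\<close>.\<close>

lemma mean_reach_ge: "(1 - (\<Sum>j\<le>t. \<delta> j)) * real (tree_card t) \<le> mean_reach t"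
proof (induction t rule: less_induct)
  case (less t)
  define D where "D = (\<Sum>j<t. \<delta> j)"
  have D0: "0 \<le> D" unfolding D_def by (intro sum_nonneg \<delta>_nonneg)
  have split: "(\<Sum>j\<le>t. \<delta> j) = D + \<delta> t" by (simp add: D_def lessThan_Suc_atMost[symmetric])
  define R where "R = real q * (\<Sum>k<t. real (loc_shell k) * real (tree_card (t - 1 - k)))"
  have a: "real (tree_card t) = real (loc_card t) + R"
    unfolding R_def by (subst tree_card.simps) simp
  have "(1 - D) * R = real q * (\<Sum>k<t. real (loc_shell k) * ((1 - D) * real (tree_card (t - 1 - k))))"
    by (simp add: R_def sum_distrib_left mult_ac)
  also have "\<dots> \<le> real q * (\<Sum>k<t. real (loc_shell k) * mean_reach (t - 1 - k))"
  proof (intro mult_left_mono sum_mono)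
    fix k assume k: "k \<in> {..<t}"
    have "(\<Sum>j\<le>t - 1 - k. \<delta> j) \<le> D"
      unfolding D_def using k by (intro sum_mono2) (auto simp: \<delta>_nonneg)
    then have "(1 - D) * real (tree_card (t - 1 - k)) \<le> (1 - (\<Sum>j\<le>t - 1 - k. \<delta> j)) * real (tree_card (t - 1 - k))"
      by (intro mult_right_mono) auto
    also have "\<dots> \<le> mean_reach (t - 1 - k)" using k by (intro less) auto
    finally show "(1 - D) * real (tree_card (t - 1 - k)) \<le> mean_reach (t - 1 - k)" .
  qed auto
  finally have "real (loc_card t) + (1 - D) * R - \<delta> t * real (tree_card t) \<le> mean_reach t"
    using mean_reach_recurrence[of t] by linarith
  moreover have "(1 - D - \<delta> t) * real (tree_card t) \<le> real (loc_card t) + (1 - D) * R - \<delta> t * real (tree_card t)"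
    unfolding a using D0 by (simp add: algebra_simps)
  ultimately show ?case by (simp add: split diff_diff_eq)
qed

end

end

subsection \<open>Hitting a local ball\<close>

lemma prob_bind_pmf_le:
  assumes "\<And>x. x \<in> set_pmf M \<Longrightarrow> measure_pmf.prob (N x) X \<le> c"
  shows "measure_pmf.prob (bind_pmf M N) X \<le> c"
proof -
  obtain x where "x \<in> set_pmf M" using set_pmf_not_empty[of M] by blast
  then have c: "0 \<le> c" using assms[of x] measure_nonneg order_trans by blast
  have "emeasure (measure_pmf (bind_pmf M N)) X = (\<integral>\<^sup>+x. emeasure (N x) X \<partial>M)" by simp
  also have "\<dots> \<le> (\<integral>\<^sup>+x. ennreal c \<partial>M)"
    using assms by (intro nn_integral_mono_AE)
      (auto simp: AE_measure_pmf_iff measure_pmf.emeasure_eq_measure intro!: ennreal_leI)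
  also have "\<dots> = ennreal c" by simp
  finally show ?thesis using c by (simp add: measure_pmf.emeasure_eq_measure)
qed

context kleinberg
begin

text \<open>The ratio by which \<open>\<delta>\<close> shrinks when the radius drops by one. It
  depends on \<open>p\<close>, \<open>q\<close> and \<open>r\<close> only, so the geometric series
  in \<open>sum_\<delta>_le\<close> is bounded by its last term uniformly in
  \<open>m\<close>.\<close>

definition \<theta> :: real where "\<theta> = (real deg_bound / (real deg_bound + 1)) powr \<gamma>"

lemma \<theta>_bounds: "0 < \<theta>" "\<theta> < 1"
proof -
  have "0 < real deg_bound / (real deg_bound + 1)" "real deg_bound / (real deg_bound + 1) < 1"
    using deg_bound_pos by auto
  then show "0 < \<theta>" "\<theta> < 1"
    unfolding \<theta>_def using \<gamma>_pos powr_less_mono2[of \<gamma> "real deg_bound / (real deg_bound + 1)" 1]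
    by (simp_all only: powr_gt_zero powr_one_eq_one)
qed

lemma tree_card_le_Suc:
  "real (tree_card t) \<le> real deg_bound / (real deg_bound + 1) * real (tree_card (Suc t))"
proof -
  have "real ((deg_bound + 1) * tree_card t) \<le> real (deg_bound * tree_card (Suc t))"
    using tree_card_growth[of t] by (simp only: of_nat_le_iff)
  then show ?thesis by (simp add: field_simps)
qed

lemma \<delta>_Suc: "\<delta> t \<le> \<theta> * \<delta> (Suc t)"
proof -
  define \<rho> where "\<rho> = real deg_bound / (real deg_bound + 1)"
  have "real (tree_card t) / (real m)\<^sup>2 \<le> \<rho> * (real (tree_card (Suc t)) / (real m)\<^sup>2)"
    using divide_right_mono[OF tree_card_le_Suc[of t], of "(real m)\<^sup>2"] by (simp add: \<rho>_def)
  then have "(real (tree_card t) / (real m)\<^sup>2) powr \<gamma>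
      \<le> (\<rho> * (real (tree_card (Suc t)) / (real m)\<^sup>2)) powr \<gamma>"
    using \<gamma>_pos by (intro powr_mono2) auto
  also have "\<dots> = \<theta> * (real (tree_card (Suc t)) / (real m)\<^sup>2) powr \<gamma>"
    unfolding \<theta>_def \<rho>_def by (rule powr_mult)
  finally show ?thesis unfolding \<delta>_def using K_pos by (simp add: mult.left_commute)
qed

lemma sum_\<delta>_le: "(\<Sum>j\<le>t. \<delta> j) \<le> \<delta> t / (1 - \<theta>)"
proof (induction t)
  case 0
  have "\<delta> 0 * (1 - \<theta>) \<le> \<delta> 0" using \<delta>_nonneg \<theta>_bounds by (intro mult_left_le) auto
  then show ?case using \<theta>_bounds by (simp add: field_simps)
next
  case (Suc t)
  have "(\<Sum>j\<le>Suc t. \<delta> j) \<le> \<theta> * \<delta> (Suc t) / (1 - \<theta>) + \<delta> (Suc t)"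
    using Suc divide_right_mono[OF \<delta>_Suc[of t], of "1 - \<theta>"] \<theta>_bounds by simp
  also have "\<dots> = \<delta> (Suc t) / (1 - \<theta>)" using \<theta>_bounds by (simp add: field_simps)
  finally show ?case .
qed

lemma prob_eq_mean: "measure_pmf.prob (kl_long m r q) {L. P L} = mean (\<lambda>L. of_bool (P L))"
proof -
  have "(\<lambda>L. of_bool (P L)) = indicat_real {L. P L}" by (auto simp: indicator_def fun_eq_iff)
  then show ?thesis by simp
qed

context
  fixes u assumes u: "u \<in> kl_nodes m"
begin

text \<open>Markov's inequality for the deficit \<open>tree_card t - card (reach L u t)\<close>,
  which is nonnegative by the deterministic upper bound.\<close>

lemma prob_small_reach_le:
  assumes "\<eta> > 0"
  shows "measure_pmf.prob (kl_long m r q) {L. real (card (reach L u t)) < (1 - \<eta>) * real (tree_card t)}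
    \<le> (\<Sum>j\<le>t. \<delta> j) / \<eta>"
proof -
  define A where "A = real (tree_card t)"
  have A: "A > 0" using tree_card_pos[of t] by (simp add: A_def)
  have "measure_pmf.prob (kl_long m r q) {L. real (card (reach L u t)) < (1 - \<eta>) * A}
      \<le> mean (\<lambda>L. (A - real (card (reach L u t))) / (\<eta> * A))"
    unfolding prob_eq_mean
  proof (rule mean_mono)
    fix L assume "valid L"
    then have "real (card (reach L u t)) \<le> A" using card_reach_le[OF u] by (simp add: A_def)
    then show "of_bool (real (card (reach L u t)) < (1 - \<eta>) * A) \<le> (A - real (card (reach L u t))) / (\<eta> * A)"
      using A assms by (auto simp: le_divide_eq algebra_simps)
  qed
  also have "\<dots> = (A - mean_reach u t) / (\<eta> * A)"
    by (simp add: mean_reach_def[OF u])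
  also have "\<dots> \<le> ((\<Sum>j\<le>t. \<delta> j) * A) / (\<eta> * A)"
    using mean_reach_ge[OF u, of t] A assms by (intro divide_right_mono) (auto simp: A_def algebra_simps)
  also have "\<dots> = (\<Sum>j\<le>t. \<delta> j) / \<eta>" using A by simp
  finally show ?thesis by (simp add: A_def)
qed

section \<open>Revealing the contacts of the outermost shell\<close>

definition explored :: "nat \<Rightarrow> (node \<times> nat \<Rightarrow> node) \<Rightarrow> node set \<times> node set" where
  "explored t L = (reach_lt L u t, reach L u t)"

text \<open>The pair records the inspected nodes and the ball. Neither depends on the contacts of a
  node outside \<open>reach_lt\<close>, so fixing the pair leaves the contacts of the shell
  free.\<close>

lemma explored_upd:
  assumes L: "valid L" and x: "x \<notin> reach_lt L u t"
  shows "explored t (L((x, i) := y)) = explored t L"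
proof -
  have "reach (L((x, i) := y)) u j = reach L u j" if "j \<le> t" for j
  proof (rule reach_cong[OF u L])
    fix z i' assume "z \<in> reach_lt L u j" "i' < q"
    then have "z \<noteq> x" using x that by (auto simp: reach_lt_def)
    then show "(L((x, i) := y)) (z, i') = L (z, i')" by simp
  qed
  then show ?thesis by (simp add: explored_def reach_lt_def)
qed

lemma explored_upd_iff:
  assumes L: "valid L" and x: "x \<notin> fst X" "x \<in> kl_nodes m" and i: "i < q" and y: "y \<in> kl_nodes m"
  shows "explored t (L((x, i) := y)) = X \<longleftrightarrow> explored t L = X"
proof
  assume X: "explored t (L((x, i) := y)) = X"
  then have "x \<notin> reach_lt (L((x, i) := y)) u t" using x by (auto simp: explored_def)
  from explored_upd[OF valid_upd[OF L y] this, of i "L (x, i)"] X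
  show "explored t L = X" by simp
next
  assume X: "explored t L = X"
  then have "x \<notin> reach_lt L u t" using x by (auto simp: explored_def)
  from explored_upd[OF L this] X show "explored t (L((x, i) := y)) = X" by simp
qed

text \<open>The contacts of \<open>D\<close> are resampled one node at a time; each leaves the event
  \<open>explored t L = X\<close> intact and costs a factor \<open>1 - \<beta>\<close>. Joint
  instead of conditional probabilities also cover values \<open>X\<close> of probability 0.\<close>

lemma prob_avoid_given_explored:
  assumes S: "\<And>x. x \<in> kl_nodes m \<Longrightarrow> \<beta> \<le> measure_pmf.prob (contact_pmf m r x) S" and \<beta>: "\<beta> \<le> 1"
    and D: "finite D" "D \<subseteq> kl_nodes m" "D \<inter> fst X = {}"
  shows "mean (\<lambda>L. of_bool (explored t L = X \<and> (\<forall>x\<in>D. L (x, 0) \<notin> S)))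
     \<le> (1 - \<beta>) ^ card D * mean (\<lambda>L. of_bool (explored t L = X))"
  using D
proof (induction D rule: finite_induct)
  case (insert x D)
  have x: "x \<in> kl_nodes m" "x \<notin> fst X" using insert by auto
  have q0: "0 < q" using q1 by simp
  define g where "g L = (of_bool (explored t L = X \<and> (\<forall>z\<in>D. L (z, 0) \<notin> S)) :: real)" for L
  have g: "g (L((x, 0) := x)) = g L" if L: "valid L" for L
  proof -
    have "(\<forall>z\<in>D. (L((x, 0) := x)) (z, 0) \<notin> S) \<longleftrightarrow> (\<forall>z\<in>D. L (z, 0) \<notin> S)"
      using insert.hyps(2) by (intro ball_cong refl) auto
    then show ?thesis
      unfolding g_def by (simp only: explored_upd_iff[OF L x(2,1) q0 x(1)])
  qed
  have "mean (\<lambda>L. of_bool (explored t L = X \<and> (\<forall>z\<in>insert x D. L (z, 0) \<notin> S)))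
     = mean (\<lambda>L. g (L((x, 0) := x)) * of_bool (L (x, 0) \<notin> S))"
    by (rule mean_cong) (auto simp: g, auto simp: g_def)
  also have "\<dots> = mean (\<lambda>L. measure_pmf.expectation (contact_pmf m r x) (\<lambda>y. g (L((x, 0) := x)) * of_bool (y \<notin> S)))"
    by (rule mean_resample[OF x(1) q0])
  also have "\<dots> = mean (\<lambda>L. g (L((x, 0) := x)) * (1 - measure_pmf.prob (contact_pmf m r x) S))"
  proof -
    have "(\<lambda>y. of_bool (y \<notin> S)) = indicat_real (- S)" by (auto simp: indicator_def fun_eq_iff)
    then have "measure_pmf.expectation (contact_pmf m r x) (\<lambda>y. of_bool (y \<notin> S))
        = 1 - measure_pmf.prob (contact_pmf m r x) S"
      by (simp add: measure_pmf.prob_compl[of S, simplified] Compl_eq_Diff_UNIV)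
    then show ?thesis by simp
  qed
  also have "\<dots> \<le> mean (\<lambda>L. (1 - \<beta>) * g L)"
  proof (rule mean_mono)
    fix L assume "valid L"
    then show "g (L((x, 0) := x)) * (1 - measure_pmf.prob (contact_pmf m r x) S) \<le> (1 - \<beta>) * g L"
      using S[OF x(1)] by (subst mult.commute) (auto simp: g, auto simp: g_def intro!: mult_right_mono)
  qed
  also have "\<dots> = (1 - \<beta>) * mean g" by simp
  also have "\<dots> \<le> (1 - \<beta>) * ((1 - \<beta>) ^ card D * mean (\<lambda>L. of_bool (explored t L = X)))"
    using insert \<beta> unfolding g_def by (intro mult_left_mono) auto
  finally show ?case using insert.hyps by (simp add: mult.assoc)
qed simp

text \<open>The shell is random, so the event is split over the finitely many values of
  \<open>explored\<close>, each of which fixes the shell. Contact number 0 exists because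
  \<open>q \<ge> 1\<close>.\<close>

lemma prob_avoid:
  assumes S: "\<And>x. x \<in> kl_nodes m \<Longrightarrow> \<beta> \<le> measure_pmf.prob (contact_pmf m r x) S"
    and \<beta>: "0 \<le> \<beta>" "\<beta> \<le> 1"
  shows "measure_pmf.prob (kl_long m r q) {L. N \<le> card (reach L u t - reach_lt L u t) \<and>
     (\<forall>x\<in>reach L u t - reach_lt L u t. L (x, 0) \<notin> S)} \<le> (1 - \<beta>) ^ N"
proof -
  define Xs where "Xs = Pow (kl_nodes m) \<times> Pow (kl_nodes m)"
  have finXs: "finite Xs" by (simp add: Xs_def)
  have mem: "explored t L \<in> Xs" if "valid L" for L
    using reach_lt_subset[OF u that] reach_subset[OF u that] by (auto simp: Xs_def explored_def)
  have one: "(\<Sum>X\<in>Xs. of_bool (P \<and> explored t L = X)) = (of_bool P :: real)" if L: "valid L" for L P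
  proof -
    have "(\<Sum>X\<in>Xs. of_bool (P \<and> explored t L = X)) = (\<Sum>X\<in>Xs. if X = explored t L then of_bool P else (0::real))"
      by (intro sum.cong) auto
    then show ?thesis using mem[OF L] finXs by simp
  qed
  define avoid where "avoid L \<longleftrightarrow> N \<le> card (reach L u t - reach_lt L u t) \<and>
     (\<forall>x\<in>reach L u t - reach_lt L u t. L (x, 0) \<notin> S)" for L
  have "mean (\<lambda>L. of_bool (avoid L)) = mean (\<lambda>L. \<Sum>X\<in>Xs. of_bool (avoid L \<and> explored t L = X))"
    by (rule mean_cong) (simp only: one)
  also have "\<dots> = (\<Sum>X\<in>Xs. mean (\<lambda>L. of_bool (avoid L \<and> explored t L = X)))" by simp
  also have "\<dots> \<le> (\<Sum>X\<in>Xs. (1 - \<beta>) ^ N * mean (\<lambda>L. of_bool (explored t L = X)))"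
  proof (rule sum_mono)
    fix X assume X: "X \<in> Xs"
    define D where "D = snd X - fst X"
    have D: "D \<subseteq> kl_nodes m" "D \<inter> fst X = {}" using X by (auto simp: D_def Xs_def)
    have finD: "finite D" using D(1) finite_subset finite_kl_nodes by blast
    have eq: "reach L u t - reach_lt L u t = D" if "explored t L = X" for L
      using that by (auto simp: explored_def D_def)
    show "mean (\<lambda>L. of_bool (avoid L \<and> explored t L = X)) \<le> (1 - \<beta>) ^ N * mean (\<lambda>L. of_bool (explored t L = X))"
    proof (cases "N \<le> card D")
      case True
      have "mean (\<lambda>L. of_bool (avoid L \<and> explored t L = X))
          \<le> mean (\<lambda>L. of_bool (explored t L = X \<and> (\<forall>x\<in>D. L (x, 0) \<notin> S)))"
        using eq by (intro mean_mono) (auto simp: avoid_def)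
      also have "\<dots> \<le> (1 - \<beta>) ^ card D * mean (\<lambda>L. of_bool (explored t L = X))"
        by (rule prob_avoid_given_explored[OF S \<beta>(2) finD D])
      also have "\<dots> \<le> (1 - \<beta>) ^ N * mean (\<lambda>L. of_bool (explored t L = X))"
        using \<beta> True by (intro mult_right_mono power_decreasing integral_nonneg_AE) auto
      finally show ?thesis .
    next
      case False
      then have "mean (\<lambda>L. of_bool (avoid L \<and> explored t L = X)) = mean (\<lambda>L. 0)"
        using eq by (intro mean_cong) (auto simp: avoid_def)
      also have "\<dots> \<le> (1 - \<beta>) ^ N * mean (\<lambda>L. of_bool (explored t L = X))"
        using \<beta> by (simp add: integral_nonneg_AE)
      finally show ?thesis .
    qed
  qed
  also have "\<dots> = (1 - \<beta>) ^ N * mean (\<lambda>L. \<Sum>X\<in>Xs. of_bool (explored t L = X))"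
    by (simp add: sum_distrib_left)
  also have "mean (\<lambda>L. \<Sum>X\<in>Xs. of_bool (explored t L = X)) = mean (\<lambda>L. 1)"
    by (rule mean_cong) (use one[where P = True] in simp)
  finally show ?thesis unfolding prob_eq_mean avoid_def by simp
qed

lemma prob_not_reach_le:
  assumes v: "v \<in> kl_nodes m" and t: "t \<ge> 1"
  shows "measure_pmf.prob (kl_long m r q) {L. v \<notin> reach L u (Suc t + k)}
    \<le> 2 * (real deg_bound + 1) * (\<delta> t / (1 - \<theta>))
      + exp (- (((2 - r) / 6)\<^sup>2 * (real (loc_card k) - 1) / (real m)\<^sup>2
           * (real (tree_card t) / (2 * (real deg_bound + 1)))))"
proof -
  \<comment> \<open>By \<open>tree_card_le_Suc\<close> the inner ball has at most
    \<open>(1 - 2 * \<eta>) * A\<close> nodes. If the ball has at least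
    \<open>(1 - \<eta>) * A\<close>, its shell has at least \<open>\<eta> * A\<close>.\<close>
  define \<eta> where "\<eta> = 1 / (2 * (real deg_bound + 1))"
  define A where "A = real (tree_card t)"
  define \<beta> where "\<beta> = ((2 - r) / 6)\<^sup>2 * (real (loc_card k) - 1) / (real m)\<^sup>2"
  define N where "N = nat \<lceil>A * \<eta>\<rceil>"
  have \<eta>: "\<eta> > 0" by (simp add: \<eta>_def add_nonneg_pos)
  have S: "\<beta> \<le> measure_pmf.prob (contact_pmf m r x) (loc v k)" if "x \<in> kl_nodes m" for x
    using contact_prob_ge[OF that r0 r2 m2 loc_subset[OF v, of k]] by (simp add: \<beta>_def card_loc[OF v])
  have \<beta>0: "0 \<le> \<beta>" using loc_card_mono[of 0 k] by (simp add: \<beta>_def)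
  have \<beta>1: "\<beta> \<le> 1" using S[OF u] measure_pmf.prob_le_1 order_trans by blast
  define P1 where "P1 L \<longleftrightarrow> real (card (reach L u t)) < (1 - \<eta>) * A" for L
  define P2 where "P2 L \<longleftrightarrow> N \<le> card (reach L u t - reach_lt L u t) \<and>
     (\<forall>x\<in>reach L u t - reach_lt L u t. L (x, 0) \<notin> loc v k)" for L
  have "measure_pmf.prob (kl_long m r q) {L. v \<notin> reach L u (Suc t + k)}
    \<le> mean (\<lambda>L. of_bool (P1 L) + of_bool (P2 L))"
    unfolding prob_eq_mean
  proof (rule mean_mono)
    fix L assume L: "valid L"
    have "P1 L \<or> P2 L" if nr: "v \<notin> reach L u (Suc t + k)"
    proof (rule disjCI)
      assume "\<not> P2 L"
      \<comment> \<open>Otherwise \<open>v\<close> is reached with \<open>t\<close> steps to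
        \<open>x\<close>, one to its contact and \<open>k\<close> local steps back, local balls
        being symmetric.\<close>
      have "L (x, 0) \<notin> loc v k" if x: "x \<in> reach L u t" for x
      proof
        assume "L (x, 0) \<in> loc v k"
        then have "v \<in> loc (L (x, 0)) k" by (rule loc_sym[OF v])
        moreover have "L (x, 0) \<in> reach L u (Suc t)" using x q1 by force
        ultimately show False using loc_subset_reach[OF u L, of "L (x, 0)" "Suc t" k] nr by blast
      qed
      then have less: "card (reach L u t - reach_lt L u t) < N" using \<open>\<not> P2 L\<close> by (auto simp: P2_def)
      obtain t' where t': "t = Suc t'" using t by (cases t) auto
      have "card (reach_lt L u t) \<le> tree_card t'"
        using card_reach_le[OF u L, of t'] by (simp add: t' reach_lt_Suc[OF u L])
      then have "real (card (reach_lt L u t)) \<le> real (tree_card t')" by simp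
      also have "\<dots> \<le> real deg_bound / (real deg_bound + 1) * A"
        unfolding A_def t' by (rule tree_card_le_Suc)
      also have "\<dots> = (1 - 2 * \<eta>) * A" by (simp add: \<eta>_def field_simps)
      finally have inner: "real (card (reach_lt L u t)) \<le> (1 - 2 * \<eta>) * A" .
      have "card (reach L u t) - card (reach_lt L u t) \<le> card (reach L u t - reach_lt L u t)"
        by (rule diff_card_le_card_Diff) simp
      then have "real (card (reach L u t)) \<le> real (card (reach L u t - reach_lt L u t)) + real (card (reach_lt L u t))"
        by linarith
      moreover have "real (card (reach L u t - reach_lt L u t)) < A * \<eta>"
        using less unfolding N_def by linarith
      ultimately show "P1 L" using inner by (simp add: P1_def algebra_simps)
    qed
    then show "of_bool (v \<notin> reach L u (Suc t + k)) \<le> (of_bool (P1 L) + of_bool (P2 L) :: real)"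
      by auto
  qed
  also have "\<dots> = measure_pmf.prob (kl_long m r q) {L. P1 L} + measure_pmf.prob (kl_long m r q) {L. P2 L}"
    by (simp add: prob_eq_mean)
  also have "measure_pmf.prob (kl_long m r q) {L. P1 L} \<le> (\<Sum>j\<le>t. \<delta> j) / \<eta>"
    unfolding P1_def A_def by (rule prob_small_reach_le[OF \<eta>])
  also have "\<dots> \<le> (\<delta> t / (1 - \<theta>)) / \<eta>"
    using \<eta> by (intro divide_right_mono sum_\<delta>_le) auto
  also have "\<dots> = 2 * (real deg_bound + 1) * (\<delta> t / (1 - \<theta>))" by (simp add: \<eta>_def)
  also have "measure_pmf.prob (kl_long m r q) {L. P2 L} \<le> (1 - \<beta>) ^ N"
    unfolding P2_def by (rule prob_avoid[OF S \<beta>0 \<beta>1])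
  also have "\<dots> \<le> exp (- \<beta>) ^ N"
    using \<beta>1 exp_ge_add_one_self[of "- \<beta>"] by (intro power_mono) auto
  also have "\<dots> = exp (- (\<beta> * real N))" by (simp add: exp_of_nat_mult[symmetric] mult.commute)
  also have "\<dots> \<le> exp (- (\<beta> * (A * \<eta>)))"
    using \<beta>0 unfolding N_def by (auto intro!: mult_left_mono) linarith
  finally show ?thesis by (simp add: \<beta>_def A_def \<eta>_def)
qed

text \<open>\<open>reach\<close> allows waiting at a node while local edges join distinct nodes
  only, so membership at radius \<open>t\<close> means a path of length at most
  \<open>t\<close>.\<close>

lemma reach_iff_graph_dist_le:
  assumes L: "valid L"
  shows "v \<in> reach L u t \<longleftrightarrow> graph_dist (kl_edges m p q L) u v \<le> enat t"
proof -
  define E where "E = kl_edges m p q L"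
  have path: "\<exists>k\<le>t. (u, v) \<in> E ^^ k" if "v \<in> reach L u t" for v
    using that
  proof (induction t arbitrary: v)
    case (Suc t)
    obtain x where x: "x \<in> reach L u t" "v \<in> nbr x \<or> (\<exists>i<q. v = L (x, i))" using Suc.prems by auto
    obtain k where k: "k \<le> t" "(u, x) \<in> E ^^ k" using Suc.IH[OF x(1)] by blast
    have V: "x \<in> kl_nodes m" "v \<in> kl_nodes m"
      using x(1) Suc.prems reach_subset[OF u L] by blast+
    show ?case
    proof (cases "v = x")
      case False
      then have "(x, v) \<in> E" using V x(2) by (auto simp: E_def kl_edges_def nbr_def)
      then have "(u, v) \<in> E ^^ Suc k" using k(2) by auto
      then show ?thesis using k(1) by (intro exI[of _ "Suc k"]) simp
    qed (use k in \<open>auto intro: le_SucI\<close>)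
  qed simp
  have 1: "graph_dist E u v \<le> enat t" if reach: "v \<in> reach L u t"
  proof -
    obtain k where "k \<le> t" "(u, v) \<in> E ^^ k" using path[OF reach] by blast
    then have "graph_dist E u v \<le> enat k" unfolding graph_dist_def by (intro Inf_lower) auto
    then show ?thesis using \<open>k \<le> t\<close> by (meson enat_ord_simps(1) order_trans)
  qed
  have rel: "v \<in> reach L u k" if "(u, v) \<in> E ^^ k" for k v
    using that
  proof (induction k arbitrary: v)
    case (Suc k)
    then obtain x where x: "(u, x) \<in> E ^^ k" "(x, v) \<in> E" by auto
    have "v \<in> nbr x \<union> (\<lambda>i. L (x, i)) ` {..<q}"
      using x(2) by (auto simp: E_def kl_edges_def nbr_def)
    then show ?case using Suc.IH[OF x(1)] by auto
  qed simp
  have 2: "v \<in> reach L u t" if "graph_dist E u v \<le> enat t"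
  proof (rule ccontr)
    assume nr: "v \<notin> reach L u t"
    have "enat (Suc t) \<le> graph_dist E u v"
      unfolding graph_dist_def
    proof (rule Inf_greatest)
      fix d assume "d \<in> {enat k |k. (u, v) \<in> E ^^ k}"
      then obtain k where k: "d = enat k" "(u, v) \<in> E ^^ k" by auto
      have "\<not> k \<le> t" using rel[OF k(2)] reach_mono[OF u L, of k t] nr by blast
      then show "enat (Suc t) \<le> d" using k by simp
    qed
    then have "enat (Suc t) \<le> enat t" using that by (rule order_trans)
    then show False by simp
  qed
  show ?thesis using 1 2 unfolding E_def by blast
qed

end

text \<open>A distance in \<open>{t + 1..t + 1 + k}\<close> does not deviate, so either
  \<open>v\<close> lies in the ball of radius \<open>t\<close> or outside that of radius
  \<open>t + 1 + k\<close>. The first event is averaged over \<open>v\<close> for a fixed network,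
  the second over networks for fixed \<open>u\<close> and \<open>v\<close>.\<close>

lemma prob_deviates_le:
  assumes t: "t \<ge> 1" and k: "real k \<le> eps * real (Suc t)"
  shows "measure_pmf.prob (kl_dist_pmf r p q m) {d. deviates (real (Suc t)) eps d}
    \<le> real (tree_card t) / (real m)\<^sup>2 + (2 * (real deg_bound + 1) * (\<delta> t / (1 - \<theta>))
      + exp (- (((2 - r) / 6)\<^sup>2 * (real (loc_card k) - 1) / (real m)\<^sup>2
           * (real (tree_card t) / (2 * (real deg_bound + 1))))))"
proof -
  define U where "U = pmf_of_set (kl_nodes m)"
  have ne: "kl_nodes m \<noteq> {}" using origin_in by blast
  have setU: "set_pmf U = kl_nodes m" unfolding U_def using ne by simp
  define J where "J = do {L \<leftarrow> kl_long m r q; u \<leftarrow> U; v \<leftarrow> U; return_pmf (L, u, v)}"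
  define g where "g = (\<lambda>(L, u, v). graph_dist (kl_edges m p q L) u v)"
  have "kl_dist_pmf r p q m = map_pmf g J"
    by (simp add: kl_dist_pmf_def J_def g_def U_def map_pmf_def bind_assoc_pmf bind_return_pmf)
  then have "measure_pmf.prob (kl_dist_pmf r p q m) {d. deviates (real (Suc t)) eps d}
      = measure_pmf.prob J (g -` {d. deviates (real (Suc t)) eps d})" by simp
  also have "\<dots> \<le> measure_pmf.prob J ({(L, u, v). v \<in> reach L u t} \<union> {(L, u, v). v \<notin> reach L u (Suc t + k)})"
  proof (rule measure_pmf.finite_measure_mono_AE)
    show "AE z in measure_pmf J. z \<in> g -` {d. deviates (real (Suc t)) eps d}
        \<longrightarrow> z \<in> {(L, u, v). v \<in> reach L u t} \<union> {(L, u, v). v \<notin> reach L u (Suc t + k)}"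
      unfolding AE_measure_pmf_iff
    proof (intro ballI impI)
      fix z assume "z \<in> set_pmf J" and dev: "z \<in> g -` {d. deviates (real (Suc t)) eps d}"
      then obtain L u v where z: "z = (L, u, v)" "L \<in> set_pmf (kl_long m r q)" "u \<in> kl_nodes m"
        by (auto simp: J_def setU)
      have L: "valid L" using z valid_kl_long by blast
      define d where "d = graph_dist (kl_edges m p q L) u v"
      have dev: "deviates (real (Suc t)) eps d" using dev by (simp add: z g_def d_def)
      have "v \<in> reach L u t \<or> v \<notin> reach L u (Suc t + k)"
      proof (rule ccontr)
        assume "\<not> ?thesis"
        then have "\<not> d \<le> enat t" "d \<le> enat (Suc t + k)"
          using reach_iff_graph_dist_le[OF z(3) L] unfolding d_def by blast+
        then obtain j where j: "d = enat j" "t < j" "j \<le> Suc t + k" by (cases d) auto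
        have "real j / real (Suc t) - 1 = (real j - real (Suc t)) / real (Suc t)"
          by (simp add: field_simps)
        moreover have "(real j - real (Suc t)) / real (Suc t) \<le> eps"
          using j k by (subst divide_le_eq) auto
        moreover have "0 \<le> (real j - real (Suc t)) / real (Suc t)" using j by simp
        ultimately have "\<bar>real j / real (Suc t) - 1\<bar> \<le> eps" by linarith
        then show False using dev j by (simp add: deviates_def)
      qed
      then show "z \<in> {(L, u, v). v \<in> reach L u t} \<union> {(L, u, v). v \<notin> reach L u (Suc t + k)}"
        by (simp add: z)
    qed
  qed auto
  also have "\<dots> \<le> measure_pmf.prob J {(L, u, v). v \<in> reach L u t}
      + measure_pmf.prob J {(L, u, v). v \<notin> reach L u (Suc t + k)}"
    by (rule measure_Un_le) auto
  also have "measure_pmf.prob J {(L, u, v). v \<in> reach L u t} \<le> real (tree_card t) / (real m)\<^sup>2"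
    unfolding J_def
  proof (rule prob_bind_pmf_le, rule prob_bind_pmf_le)
    fix L u assume L: "L \<in> set_pmf (kl_long m r q)" and "u \<in> set_pmf U"
    then have u: "u \<in> kl_nodes m" by (simp add: setU)
    have "measure_pmf.prob (bind_pmf U (\<lambda>v. return_pmf (L, u, v))) {(L, u, v). v \<in> reach L u t}
       = measure_pmf.prob U (reach L u t)"
      by (simp add: map_pmf_def[symmetric] vimage_def)
    also have "\<dots> = real (card (kl_nodes m \<inter> reach L u t)) / real (card (kl_nodes m))"
      unfolding U_def using ne by (intro measure_pmf_of_set) auto
    also have "\<dots> = real (card (reach L u t)) / (real m)\<^sup>2"
      using reach_subset[OF u valid_kl_long[OF L], of t] by (simp add: Int_absorb1)
    also have "\<dots> \<le> real (tree_card t) / (real m)\<^sup>2"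
      using card_reach_le[OF u valid_kl_long[OF L], of t] by (intro divide_right_mono) auto
    finally show "measure_pmf.prob (bind_pmf U (\<lambda>v. return_pmf (L, u, v))) {(L, u, v). v \<in> reach L u t}
       \<le> real (tree_card t) / (real m)\<^sup>2" .
  qed
  also have "measure_pmf.prob J {(L, u, v). v \<notin> reach L u (Suc t + k)} \<le> (2 * (real deg_bound + 1) * (\<delta> t / (1 - \<theta>))
      + exp (- (((2 - r) / 6)\<^sup>2 * (real (loc_card k) - 1) / (real m)\<^sup>2
           * (real (tree_card t) / (2 * (real deg_bound + 1))))))"
  proof -
    have "J = do {u \<leftarrow> U; L \<leftarrow> kl_long m r q; v \<leftarrow> U; return_pmf (L, u, v)}"
      unfolding J_def by (rule bind_commute_pmf)
    also have "\<dots> = do {u \<leftarrow> U; v \<leftarrow> U; L \<leftarrow> kl_long m r q; return_pmf (L, u, v)}"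
      by (rule bind_pmf_cong[OF refl], rule bind_commute_pmf)
    finally have J: "J = do {u \<leftarrow> U; v \<leftarrow> U; L \<leftarrow> kl_long m r q; return_pmf (L, u, v)}" .
    show ?thesis unfolding J
    proof (rule prob_bind_pmf_le, rule prob_bind_pmf_le, goal_cases)
      case (1 u v)
      then have uv: "u \<in> kl_nodes m" "v \<in> kl_nodes m" by (simp_all add: setU)
      have "measure_pmf.prob (bind_pmf (kl_long m r q) (\<lambda>L. return_pmf (L, u, v))) {(L, u, v). v \<notin> reach L u (Suc t + k)}
        = measure_pmf.prob (kl_long m r q) {L. v \<notin> reach L u (Suc t + k)}"
        by (simp add: map_pmf_def[symmetric] vimage_def)
      then show ?case using prob_not_reach_le[OF uv t, of k] by (simp del: reach.simps)
    qed
  qed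
  finally show ?thesis by simp
qed

end

subsection \<open>The typical distance\<close>

context kleinberg
begin

lemma tree_card_ge_power: "((real deg_bound + 1) / real deg_bound) ^ t \<le> real (tree_card t)"
proof (induction t)
  case (Suc t)
  have "((real deg_bound + 1) / real deg_bound) * real (tree_card t) \<le> real (tree_card (Suc t))"
    using tree_card_le_Suc[of t] deg_bound_pos by (simp add: field_simps)
  moreover have "((real deg_bound + 1) / real deg_bound) * ((real deg_bound + 1) / real deg_bound) ^ t
      \<le> ((real deg_bound + 1) / real deg_bound) * real (tree_card t)"
    using Suc by (intro mult_left_mono) auto
  ultimately show ?case by simp
qed simp

lemma tree_card_le_power: "tree_card t \<le> deg_bound ^ t"
proof (induction t)
  case (Suc t)
  then show ?case using tree_card_Suc_le[of t] by (simp add: order_trans[OF _ mult_left_mono])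
qed simp

text \<open>The bound of \<open>prob_deviates_le\<close> with \<open>tree_card t / m\<^sup>2\<close>
  confined between \<open>1 / (deg_bound * sqrt (t + 1))\<close> and \<open>1 / sqrt t\<close>. What
  remains depends on \<open>t\<close> but not on \<open>m\<close>.\<close>

definition deviation_bound :: "real \<Rightarrow> nat \<Rightarrow> real" where
  "deviation_bound eps t = 1 / sqrt (real t)
     + (2 * (real deg_bound + 1) * (K * (1 / sqrt (real t)) powr \<gamma> / (1 - \<theta>))
     + exp (- (((2 - r) / 6)\<^sup>2 * (min eps 1 * (real t + 1) - 1)
         / (2 * (real deg_bound + 1) * real deg_bound * sqrt (real t + 1)))))"

lemma prob_deviates_le_bound:
  assumes t: "t \<ge> 1" and lt: "sqrt (real t) * real (tree_card t) < (real m)\<^sup>2"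
    and ge: "(real m)\<^sup>2 \<le> sqrt (real (Suc t)) * real (tree_card (Suc t))"
    and tm: "Suc t \<le> m" and eps: "eps > 0"
  shows "measure_pmf.prob (kl_dist_pmf r p q m) {d. deviates (real (Suc t)) eps d}
    \<le> deviation_bound eps t"
proof -
  define k where "k = nat \<lfloor>eps * real (Suc t)\<rfloor>"
  define A where "A = real (tree_card t)"
  define Cd where "Cd = real deg_bound"
  have Cd: "Cd > 0" using deg_bound_pos by (simp add: Cd_def)
  have M: "(real m)\<^sup>2 > 0" using m2 by simp
  have st: "sqrt (real t) > 0" "sqrt (real t + 1) > 0" using t by auto
  have k_le: "real k \<le> eps * real (Suc t)" using eps unfolding k_def by (simp add: of_nat_nat)
  have small: "A / (real m)\<^sup>2 \<le> 1 / sqrt (real t)"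
    using lt M st by (simp add: A_def field_simps)
  have \<delta>: "\<delta> t \<le> K * (1 / sqrt (real t)) powr \<gamma>"
    unfolding \<delta>_def A_def[symmetric] using small K_pos \<gamma>_pos M
    by (intro mult_left_mono powr_mono2) (auto simp: A_def)
  have \<delta>': "2 * (Cd + 1) * (\<delta> t / (1 - \<theta>)) \<le> 2 * (Cd + 1) * (K * (1 / sqrt (real t)) powr \<gamma> / (1 - \<theta>))"
    using \<delta> \<theta>_bounds Cd by (intro mult_left_mono divide_right_mono) auto
  define y where "y = 1 / (Cd * sqrt (real t + 1))"
  have "(real m)\<^sup>2 \<le> sqrt (real t + 1) * (Cd * A)"
  proof -
    have "real (tree_card (Suc t)) \<le> real (deg_bound * tree_card t)"
      using tree_card_Suc_le[of t] by (simp only: of_nat_le_iff)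
    then have "sqrt (real (Suc t)) * real (tree_card (Suc t)) \<le> sqrt (real (Suc t)) * (Cd * A)"
      by (intro mult_left_mono) (auto simp: Cd_def A_def)
    then have "(real m)\<^sup>2 \<le> sqrt (real (Suc t)) * (Cd * A)" using ge by linarith
    then show ?thesis by (simp add: add.commute)
  qed
  then have y: "y \<le> A / (real m)\<^sup>2" using M st Cd by (simp add: y_def field_simps)
  have y0: "0 \<le> y" using Cd st by (simp add: y_def)
  \<comment> \<open>A lower bound for \<open>loc_card k - 1\<close>. Since
    \<open>loc_card_ge\<close> is capped at \<open>m\<close>, \<open>eps\<close> is capped at 1, and
    \<open>Suc t \<le> m\<close> keeps \<open>x + 1\<close> below the cap.\<close>
  define x where "x = min eps 1 * (real t + 1) - 1"
  have b1: "real (min (Suc k) m) \<le> real (loc_card k)" using loc_card_ge[of k] by simp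
  have "eps * (real t + 1) \<le> real k + 1" unfolding k_def using eps by (simp add: add.commute) linarith
  moreover have "min eps 1 * (real t + 1) \<le> eps * (real t + 1)" by (intro mult_right_mono) auto
  ultimately have "x + 1 \<le> real k + 1" unfolding x_def by linarith
  moreover have "x + 1 \<le> real m"
  proof -
    have "x + 1 = min eps 1 * (real t + 1)" by (simp add: x_def)
    also have "\<dots> \<le> 1 * (real t + 1)" by (rule mult_right_mono) auto
    also have "\<dots> \<le> real m" using tm by simp
    finally show ?thesis .
  qed
  ultimately have "x + 1 \<le> real (min (Suc k) m)" by (simp add: min_def)
  then have xb: "x \<le> real (loc_card k) - 1" using b1 by simp
  have b0: "0 \<le> real (loc_card k) - 1" using loc_card_mono[of 0 k] by simp
  have "x * y \<le> (real (loc_card k) - 1) * y" using xb y0 by (rule mult_right_mono)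
  also have "\<dots> \<le> (real (loc_card k) - 1) * (A / (real m)\<^sup>2)" using y b0 by (rule mult_left_mono)
  finally have "((2 - r) / 6)\<^sup>2 / (2 * (Cd + 1)) * (x * y)
     \<le> ((2 - r) / 6)\<^sup>2 / (2 * (Cd + 1)) * ((real (loc_card k) - 1) * (A / (real m)\<^sup>2))"
    using Cd by (intro mult_left_mono) auto
  then have e: "exp (- (((2 - r) / 6)\<^sup>2 * (real (loc_card k) - 1) / (real m)\<^sup>2 * (A / (2 * (Cd + 1)))))
     \<le> exp (- (((2 - r) / 6)\<^sup>2 * x / (2 * (Cd + 1) * Cd * sqrt (real t + 1))))"
    by (simp add: y_def mult_ac)
  show ?thesis
    using prob_deviates_le[OF t k_le] small \<delta>' e
    unfolding deviation_bound_def A_def Cd_def x_def by linarith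
qed

text \<open>The square root strikes the balance: the density of the ball tends to 0 like
  \<open>1 / sqrt t\<close>, yet its product with the size of the target ball, of order at least
  \<open>t\<close>, still diverges.\<close>

lemma deviation_bound_tendsto_0:
  assumes "eps > 0"
  shows "deviation_bound eps \<longlonglongrightarrow> 0"
proof -
  define e where "e = min eps 1"
  define c where "c = ((2 - r) / 6)\<^sup>2"
  define d where "d = 2 * (real deg_bound + 1) * real deg_bound"
  have e: "e > 0" using assms by (simp add: e_def)
  have c: "c > 0" using r2 by (simp add: c_def)
  have d: "d > 0" using deg_bound_pos by (simp add: d_def)
  have 1: "(\<lambda>t. 1 / sqrt (real t)) \<longlonglongrightarrow> 0" by real_asymp
  have 2: "(\<lambda>t. (1 / sqrt (real t)) powr \<gamma>) \<longlonglongrightarrow> 0" using \<gamma>_pos by real_asymp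
  have 3: "(\<lambda>t. exp (- (c * (e * (real t + 1) - 1) / (d * sqrt (real t + 1))))) \<longlonglongrightarrow> 0"
    using e c d by real_asymp
  have "(\<lambda>t. 1 / sqrt (real t) + (2 * (real deg_bound + 1) * (K * (1 / sqrt (real t)) powr \<gamma> / (1 - \<theta>))
     + exp (- (c * (e * (real t + 1) - 1) / (d * sqrt (real t + 1))))))
     \<longlonglongrightarrow> 0 + (2 * (real deg_bound + 1) * (K * 0 / (1 - \<theta>)) + 0)"
    using \<theta>_bounds by (intro tendsto_add tendsto_mult tendsto_divide tendsto_const 1 2 3) auto
  then show ?thesis by (simp add: deviation_bound_def[abs_def] e_def c_def d_def)
qed

end

theorem theorem3:
  fixes p q :: nat and r :: real
  assumes "p \<ge> 1" and "q \<ge> 1" and "0 \<le> r" and "r < 2"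
  shows "\<exists>f :: nat \<Rightarrow> real. \<forall>eps > 0.
           (\<lambda>m. measure_pmf.prob (kl_dist_pmf r p q m) {d. deviates (f (m\<^sup>2)) eps d})
             \<longlonglongrightarrow> 0"
proof -
  have kb: "kleinberg m p q r" if "m \<ge> 2" for m
    using assms that by unfold_locales
  \<comment> \<open>\<open>deg_bound\<close> and \<open>deviation_bound\<close> do not involve
    \<open>m\<close>, so facts about them can be taken from the single instance
    \<open>m = 2\<close>.\<close>
  have kb2: "kleinberg 2 p q r" using kb by simp
  define tc where "tc m = kleinberg.tree_card m p q" for m
  define Cd where "Cd = kleinberg.deg_bound p q"
  define T where "T m = (LEAST t. (real m)\<^sup>2 \<le> sqrt (real t) * real (tc m t))" for m
  \<comment> \<open>\<open>f\<close> takes the number of nodes \<open>m\<^sup>2\<close> as its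
    argument, and the square root recovers \<open>m\<close>.\<close>
  define f where "f k = real (T (nat \<lfloor>sqrt (real k)\<rfloor>))" for k
  have f: "f (m\<^sup>2) = real (T m)" for m by (simp add: f_def)
  have Cd: "Cd > 0" using kleinberg.deg_bound_pos[OF kb2] by (simp add: Cd_def)
  \<comment> \<open>Exponential growth at a rate independent of \<open>m\<close> shows that the
    \<open>LEAST\<close> exists and that \<open>T m \<le> m\<close>.\<close>
  have ex: "eventually (\<lambda>m. (real m)\<^sup>2 \<le> sqrt (real m) * real (tc m m)) sequentially"
  proof -
    define \<rho> where "\<rho> = (real Cd + 1) / real Cd"
    have "\<rho> > 1" using Cd by (simp add: \<rho>_def)
    then have "eventually (\<lambda>m. (real m)\<^sup>2 \<le> sqrt (real m) * \<rho> ^ m) sequentially" by real_asymp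
    then show ?thesis using eventually_ge_at_top[of 2]
    proof eventually_elim
      case (elim m)
      have "\<rho> ^ m \<le> real (tc m m)"
        using kleinberg.tree_card_ge_power[OF kb[OF elim(2)]] by (simp add: \<rho>_def Cd_def tc_def)
      then have "sqrt (real m) * \<rho> ^ m \<le> sqrt (real m) * real (tc m m)" by (intro mult_left_mono) auto
      then show ?case using elim by linarith
    qed
  qed
  \<comment> \<open>Conversely \<open>tree_card t \<le> deg_bound ^ t\<close> for every
    \<open>m\<close>, so no fixed radius can reach the threshold \<open>m\<^sup>2\<close> for large
    \<open>m\<close>.\<close>
  have large: "eventually (\<lambda>m. N < T m) sequentially" for N
  proof -
    have "eventually (\<lambda>m. sqrt (real N) * real (Cd ^ N) < (real m)\<^sup>2) sequentially" by real_asymp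
    then show ?thesis using eventually_ge_at_top[of 2] ex
    proof eventually_elim
      case (elim m)
      have T: "(real m)\<^sup>2 \<le> sqrt (real (T m)) * real (tc m (T m))"
        unfolding T_def using elim(3) by (rule LeastI)
      show ?case
      proof (rule ccontr)
        assume "\<not> N < T m"
        then have le: "T m \<le> N" by simp
        have "tc m (T m) \<le> Cd ^ T m"
          using kleinberg.tree_card_le_power[OF kb[OF elim(2)]] by (simp add: Cd_def tc_def)
        also have "\<dots> \<le> Cd ^ N" using Cd le by (intro power_increasing) auto
        finally have "sqrt (real (T m)) * real (tc m (T m)) \<le> sqrt (real N) * real (Cd ^ N)"
          using le by (intro mult_mono) (auto simp del: of_nat_power)
        then show False using T elim(1) by linarith
      qed
    qed
  qed
  have lim: "filterlim (\<lambda>m. T m - 1) at_top sequentially"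
    unfolding filterlim_at_top
  proof
    fix N
    show "eventually (\<lambda>m. N \<le> T m - 1) sequentially" using large[of N] by eventually_elim simp
  qed
  have "(\<lambda>m. measure_pmf.prob (kl_dist_pmf r p q m) {d. deviates (f (m\<^sup>2)) eps d}) \<longlonglongrightarrow> 0"
    if eps: "eps > 0" for eps
  proof (rule tendsto_sandwich[where f = "\<lambda>_. 0"])
    show "eventually (\<lambda>m. measure_pmf.prob (kl_dist_pmf r p q m) {d. deviates (f (m\<^sup>2)) eps d}
       \<le> kleinberg.deviation_bound p q r eps (T m - 1)) sequentially"
      using large[of 1] ex eventually_ge_at_top[of 2]
    proof eventually_elim
      case (elim m)
      define t where "t = T m - 1"
      have Tt: "T m = Suc t" "t \<ge> 1" using elim by (auto simp: t_def)
      have "T m \<le> m" unfolding T_def using elim(2) by (rule Least_le)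
      moreover have "(real m)\<^sup>2 \<le> sqrt (real (T m)) * real (tc m (T m))"
        unfolding T_def using elim(2) by (rule LeastI)
      \<comment> \<open>Minimality of \<open>T m\<close> bounds the ball one radius earlier, which
        is the smallness hypothesis on \<open>tree_card t\<close>.\<close>
      moreover have "\<not> (real m)\<^sup>2 \<le> sqrt (real t) * real (tc m t)"
        by (rule not_less_Least) (use Tt in \<open>simp add: T_def[symmetric]\<close>)
      ultimately have "measure_pmf.prob (kl_dist_pmf r p q m) {d. deviates (real (Suc t)) eps d}
         \<le> kleinberg.deviation_bound p q r eps t"
        using Tt eps by (intro kleinberg.prob_deviates_le_bound[OF kb[OF elim(3)]]) (auto simp: tc_def)
      then show ?case by (simp add: f Tt)
    qed
    show "(\<lambda>m. kleinberg.deviation_bound p q r eps (T m - 1)) \<longlonglongrightarrow> 0"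
      by (rule filterlim_compose[OF kleinberg.deviation_bound_tendsto_0[OF kb2 eps] lim])
  qed simp_all
  then show ?thesis by blast
qed

end
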